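(* Let $G$ be a metric Lie group, i.e. a Lie group endowed with a left-invariant Riemannian metric. If $G$ is isomorphic (as a Lie group) to $\mathrm{Sol}_3$, then $G$ is non-parabolic; that is, there exists a nonconstant positive superharmonic function defined on all of $G$.
   Context: The group $\mathrm{Sol}_3$ (the group of isometries of the Minkowski plane, understood as the connected, simply connected 3-dimensional Lie group) is the semidirect product $\mathbb{R}^2\rtimes_A\mathbb{R}$ with $A=\begin{pmatrix}1&0\\0&-1\end{pmatrix}$, that is, $\mathbb{R}^3$ with the group operation $(x_1,y_1,z_1)*(x_2,y_2,z_2)=(x_1+e^{z_1}x_2,\; y_1+e^{-z_1}y_2,\; z_1+z_2)$. A complete Riemannian manifold $M$ is called parabolic if every positive superharmonic function defined on all of $M$ is constant; otherwise $M$ is called non-parabolic. Superharmonic is meant in the usual sense with respect to the Laplace–Beltrami operator $\Delta=\mathrm{div}\,\mathrm{grad}$ of the Riemannian metric (for a $C^2$ function $u$ it means $\Delta u\le 0$). Left-invariant Riemannian metrics on Lie groups are always complete. *)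

theory Defs
  imports "HOL-Analysis.Analysis" "HOL-Algebra.Group"
begin

section \<open>Smooth functions on open subsets of a Euclidean space\<close>

text \<open>The sets \<^term>\<open>S\<close> below are always open, so that \<open>at x\<close> and \<open>at x within S\<close> agree.\<close>

primrec C_k_on ::
  "nat \<Rightarrow> 'e::real_normed_vector set \<Rightarrow> ('e \<Rightarrow> 'f::real_normed_vector) \<Rightarrow> bool" where
  "C_k_on 0 S f \<longleftrightarrow> continuous_on S f"
| "C_k_on (Suc k) S f \<longleftrightarrow>
     (\<forall>x\<in>S. f differentiable (at x)) \<and>
     (\<forall>v. C_k_on k S (\<lambda>x. frechet_derivative f (at x) v))"

definition smooth_on ::
  "'e::real_normed_vector set \<Rightarrow> ('e \<Rightarrow> 'f::real_normed_vector) \<Rightarrow> bool" where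
  "smooth_on S f \<longleftrightarrow> (\<forall>k. C_k_on k S f)"


section \<open>Smooth manifolds\<close>

text \<open>
  A manifold is a topology together with a smooth atlas (not required to be maximal). A chart is
  its domain paired with its coordinate map; values of the coordinate map outside the domain are
  irrelevant.
\<close>

type_synonym ('a, 'e) chart = "'a set \<times> ('a \<Rightarrow> 'e)"

definition chart_inv :: "('a, 'e) chart \<Rightarrow> 'e \<Rightarrow> 'a" where
  "chart_inv c = inv_into (fst c) (snd c)"

definition local_rep ::
  "('a, 'e) chart \<Rightarrow> ('b, 'f) chart \<Rightarrow> ('a \<Rightarrow> 'b) \<Rightarrow> 'e \<Rightarrow> 'f" where
  "local_rep c d f = (\<lambda>x. snd d (f (chart_inv c x)))"

definition local_smooth ::
  "('a, 'e::euclidean_space) chart \<Rightarrow> ('b, 'f::euclidean_space) chart \<Rightarrow> ('a \<Rightarrow> 'b) \<Rightarrow> bool" where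
  "local_smooth c d f \<longleftrightarrow> smooth_on (snd c ` {p \<in> fst c. f p \<in> fst d}) (local_rep c d f)"

definition is_chart :: "'a topology \<Rightarrow> ('a, 'e::euclidean_space) chart \<Rightarrow> bool" where
  "is_chart T c \<longleftrightarrow>
     openin T (fst c) \<and> open (snd c ` fst c) \<and>
     homeomorphic_map (subtopology T (fst c)) (top_of_set (snd c ` fst c)) (snd c)"

definition smooth_manifold :: "'a topology \<Rightarrow> ('a, 'e::euclidean_space) chart set \<Rightarrow> bool" where
  "smooth_manifold T A \<longleftrightarrow>
     Hausdorff_space T \<and> second_countable T \<and>
     (\<forall>c\<in>A. is_chart T c) \<and> (\<Union>c\<in>A. fst c) = topspace T \<and>
     (\<forall>c\<in>A. \<forall>d\<in>A. local_smooth c d (\<lambda>p. p))"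

definition smooth_map ::
  "'a topology \<Rightarrow> ('a, 'e::euclidean_space) chart set \<Rightarrow>
   'b topology \<Rightarrow> ('b, 'f::euclidean_space) chart set \<Rightarrow> ('a \<Rightarrow> 'b) \<Rightarrow> bool" where
  "smooth_map T A T' A' f \<longleftrightarrow>
     continuous_map T T' f \<and> (\<forall>c\<in>A. \<forall>d\<in>A'. local_smooth c d f)"

definition prod_atlas ::
  "('a, 'e) chart set \<Rightarrow> ('b, 'f) chart set \<Rightarrow> ('a \<times> 'b, 'e \<times> 'f) chart set" where
  "prod_atlas A B = (\<lambda>(c, d). (fst c \<times> fst d, map_prod (snd c) (snd d))) ` (A \<times> B)"


section \<open>Lie groups\<close>

definition lie_group ::
  "'a monoid \<Rightarrow> 'a topology \<Rightarrow> ('a, 'e::euclidean_space) chart set \<Rightarrow> bool" where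
  "lie_group G T A \<longleftrightarrow>
     group G \<and> carrier G = topspace T \<and> smooth_manifold T A \<and>
     smooth_map (prod_topology T T) (prod_atlas A A) T A (\<lambda>(p, q). p \<otimes>\<^bsub>G\<^esub> q) \<and>
     smooth_map T A T A (\<lambda>p. inv\<^bsub>G\<^esub> p)"

definition lie_group_isomorphic ::
  "'a monoid \<Rightarrow> 'a topology \<Rightarrow> ('a, 'e::euclidean_space) chart set \<Rightarrow>
   'b monoid \<Rightarrow> 'b topology \<Rightarrow> ('b, 'f::euclidean_space) chart set \<Rightarrow> bool" where
  "lie_group_isomorphic G T A H T' A' \<longleftrightarrow>
     (\<exists>\<Phi>\<in>iso G H. smooth_map T A T' A' \<Phi> \<and> smooth_map T' A' T A (inv_into (carrier G) \<Phi>))"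

definition Sol3 :: "(real \<times> real \<times> real) monoid" where
  "Sol3 = \<lparr>carrier = UNIV,
     monoid.mult = (\<lambda>(x\<^sub>1, y\<^sub>1, z\<^sub>1) (x\<^sub>2, y\<^sub>2, z\<^sub>2). (x\<^sub>1 + exp z\<^sub>1 * x\<^sub>2, y\<^sub>1 + exp (- z\<^sub>1) * y\<^sub>2, z\<^sub>1 + z\<^sub>2)),
     one = (0, 0, 0)\<rparr>"

definition euclidean_atlas :: "('e::euclidean_space, 'e) chart set" where
  "euclidean_atlas = {(UNIV, \<lambda>x. x)}"

lemma group_Sol3: "group Sol3"
proof (rule groupI)
  fix p assume "p \<in> carrier Sol3"
  obtain x y z where p: "p = (x, y, z)" by (cases p)
  show "\<exists>q\<in>carrier Sol3. q \<otimes>\<^bsub>Sol3\<^esub> p = \<one>\<^bsub>Sol3\<^esub>"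
    by (rule bexI[of _ "(- exp (- z) * x, - exp z * y, - z)"]) (auto simp: Sol3_def p)
qed (auto simp: Sol3_def field_simps exp_add exp_diff exp_minus)


section \<open>Riemannian metrics\<close>

text \<open>
  A metric is given by its coordinate expressions: \<open>g c x v w\<close> is the inner product, at the point
  with coordinates \<open>x\<close> in the chart \<open>c\<close>, of the tangent vectors with components \<open>v\<close> and \<open>w\<close>.
  The predicate below says that the differential of \<open>f\<close> preserves these inner products; for
  the identity map this is the transformation law of a covariant 2-tensor under change of chart.
\<close>

type_synonym ('a, 'e) metric = "('a, 'e) chart \<Rightarrow> 'e \<Rightarrow> 'e \<Rightarrow> 'e \<Rightarrow> real"

definition preserves_metric ::
  "('a, 'e::euclidean_space) chart set \<Rightarrow> ('a, 'e) metric \<Rightarrow> ('a \<Rightarrow> 'a) \<Rightarrow> bool" where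
  "preserves_metric A g f \<longleftrightarrow>
     (\<forall>c\<in>A. \<forall>d\<in>A. \<forall>p\<in>fst c. f p \<in> fst d \<longrightarrow>
       (\<forall>v w. g c (snd c p) v w =
          g d (snd d (f p))
            (frechet_derivative (local_rep c d f) (at (snd c p)) v)
            (frechet_derivative (local_rep c d f) (at (snd c p)) w)))"

definition riemannian_metric ::
  "('a, 'e::euclidean_space) chart set \<Rightarrow> ('a, 'e) metric \<Rightarrow> bool" where
  "riemannian_metric A g \<longleftrightarrow>
     (\<forall>c\<in>A.
        (\<forall>x\<in>snd c ` fst c.
           bilinear (g c x) \<and> (\<forall>v w. g c x v w = g c x w v) \<and> (\<forall>v. v \<noteq> 0 \<longrightarrow> 0 < g c x v v)) \<and>
        (\<forall>v w. smooth_on (snd c ` fst c) (\<lambda>x. g c x v w))) \<and>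
     preserves_metric A g (\<lambda>p. p)"

definition metric_lie_group ::
  "'a monoid \<Rightarrow> 'a topology \<Rightarrow> ('a, 'e::euclidean_space) chart set \<Rightarrow> ('a, 'e) metric \<Rightarrow> bool" where
  "metric_lie_group G T A g \<longleftrightarrow>
     lie_group G T A \<and> riemannian_metric A g \<and>
     (\<forall>a\<in>carrier G. preserves_metric A g (\<lambda>p. a \<otimes>\<^bsub>G\<^esub> p))"


section \<open>The Laplace--Beltrami operator\<close>

text \<open>
  First in coordinates, for a metric \<open>\<gamma>\<close> on an open subset of a Euclidean space.
  \<open>christoffel \<gamma> x v w\<close> is the vector with \<open>i\<close>-th component \<open>\<Gamma>\<^sup>i\<^sub>j\<^sub>k v\<^sup>j w\<^sup>k\<close>, and the
  divergence of \<open>X\<close> is the trace of its Levi-Civita covariant derivative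
  \<open>v \<mapsto> DX(v) + \<Gamma>(v, X)\<close>.
\<close>

definition gradient ::
  "('e::euclidean_space \<Rightarrow> 'e \<Rightarrow> 'e \<Rightarrow> real) \<Rightarrow> ('e \<Rightarrow> real) \<Rightarrow> 'e \<Rightarrow> 'e" where
  "gradient \<gamma> u x = (THE X. \<forall>w. \<gamma> x X w = frechet_derivative u (at x) w)"

definition christoffel ::
  "('e::euclidean_space \<Rightarrow> 'e \<Rightarrow> 'e \<Rightarrow> real) \<Rightarrow> 'e \<Rightarrow> 'e \<Rightarrow> 'e \<Rightarrow> 'e" where
  "christoffel \<gamma> x v w = (THE Z. \<forall>k. \<gamma> x Z k =
     (frechet_derivative (\<lambda>y. \<gamma> y w k) (at x) v +
      frechet_derivative (\<lambda>y. \<gamma> y v k) (at x) w -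
      frechet_derivative (\<lambda>y. \<gamma> y v w) (at x) k) / 2)"

definition divergence ::
  "('e::euclidean_space \<Rightarrow> 'e \<Rightarrow> 'e \<Rightarrow> real) \<Rightarrow> ('e \<Rightarrow> 'e) \<Rightarrow> 'e \<Rightarrow> real" where
  "divergence \<gamma> X x =
     (\<Sum>b\<in>Basis. (frechet_derivative X (at x) b + christoffel \<gamma> x b (X x)) \<bullet> b)"

definition laplacian ::
  "('e::euclidean_space \<Rightarrow> 'e \<Rightarrow> 'e \<Rightarrow> real) \<Rightarrow> ('e \<Rightarrow> real) \<Rightarrow> 'e \<Rightarrow> real" where
  "laplacian \<gamma> u x = divergence \<gamma> (gradient \<gamma> u) x"

text \<open>On a manifold, at a point \<open>p\<close> of the chart \<open>c\<close>; the value does not depend on \<open>c\<close>.\<close>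

definition laplace_beltrami ::
  "('a, 'e::euclidean_space) metric \<Rightarrow> ('a, 'e) chart \<Rightarrow> ('a \<Rightarrow> real) \<Rightarrow> 'a \<Rightarrow> real" where
  "laplace_beltrami g c u p = laplacian (g c) (\<lambda>x. u (chart_inv c x)) (snd c p)"


section \<open>Superharmonic functions and parabolicity\<close>

definition harmonic_on ::
  "('a, 'e::euclidean_space) chart set \<Rightarrow> ('a, 'e) metric \<Rightarrow> 'a set \<Rightarrow> ('a \<Rightarrow> real) \<Rightarrow> bool" where
  "harmonic_on A g \<Omega> h \<longleftrightarrow>
     (\<forall>c\<in>A. C_k_on 2 (snd c ` (fst c \<inter> \<Omega>)) (\<lambda>x. h (chart_inv c x)) \<and>
            (\<forall>p\<in>fst c \<inter> \<Omega>. laplace_beltrami g c h p = 0))"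

text \<open>
  Superharmonic functions on the whole manifold are lower semicontinuous and lie above every
  harmonic function that they dominate on the boundary of a relatively compact domain; for
  \<open>C\<^sup>2\<close> functions this amounts to a nonpositive Laplacian. Domains without boundary, i.e.
  compact components, are excluded, since there the boundary condition would be vacuous.
\<close>

definition superharmonic ::
  "'a topology \<Rightarrow> ('a, 'e::euclidean_space) chart set \<Rightarrow> ('a, 'e) metric \<Rightarrow> ('a \<Rightarrow> real) \<Rightarrow> bool" where
  "superharmonic T A g u \<longleftrightarrow>
     (\<forall>t. openin T {p \<in> topspace T. t < u p}) \<and>
     (\<forall>\<Omega> h. openin T \<Omega> \<and> connectedin T \<Omega> \<and> compactin T (T closure_of \<Omega>) \<and>
        T frontier_of \<Omega> \<noteq> {} \<and>
        continuous_map (subtopology T (T closure_of \<Omega>)) euclideanreal h \<and>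
        harmonic_on A g \<Omega> h \<and> (\<forall>p\<in>T frontier_of \<Omega>. h p \<le> u p)
        \<longrightarrow> (\<forall>p\<in>\<Omega>. h p \<le> u p))"

definition parabolic ::
  "'a topology \<Rightarrow> ('a, 'e::euclidean_space) chart set \<Rightarrow> ('a, 'e) metric \<Rightarrow> bool" where
  "parabolic T A g \<longleftrightarrow>
     (\<forall>u. superharmonic T A g u \<and> (\<forall>p\<in>topspace T. 0 < u p)
        \<longrightarrow> (\<exists>k. \<forall>p\<in>topspace T. u p = k))"

end

theory Submission
  imports Defs
begin

text \<open>
  Transport the metric to \<open>Sol\<^sub>3\<close> and orthonormalise the left-invariant fields
  \<open>exp (-z) \<partial>\<^sub>y\<close>, \<open>exp z \<partial>\<^sub>x\<close>, \<open>\<partial>\<^sub>z\<close> in this order, obtaining an orthonormal frame \<open>E\<^sub>1, E\<^sub>2, E\<^sub>3\<close>. Since the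
  group is unimodular, the \<open>E\<^sub>i\<close> are divergence free and the Laplacian is \<open>\<Sum>\<^sub>i E\<^sub>i E\<^sub>i\<close>. On functions of
  \<open>(x, z)\<close> the field \<open>E\<^sub>1\<close> vanishes, and after the substitution \<open>w = exp z\<close>, \<open>\<xi> = x - b w\<close> the operator
  becomes, up to scaling and the factor \<open>w\<^sup>2\<close>, the Laplacian of Euclidean 3-space on functions that
  are symmetric about the \<open>\<xi>\<close>-axis, with \<open>w\<close> the distance to the axis. Hence the regularised Newtonian
  potential \<open>u = (1 + s \<xi>\<^sup>2 + w\<^sup>2) powr (-1/2)\<close> is positive, nonconstant and strictly superharmonic, and it satisfies
  the comparison principle with harmonic functions \<open>h\<close>, because the Laplacian of \<open>h - u\<close>
  is positive and so \<open>h - u\<close> has no interior maximum.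
\<close>


section \<open>Second derivatives\<close>

abbreviation fderiv :: "('e::real_normed_vector \<Rightarrow> 'f::real_normed_vector) \<Rightarrow> 'e \<Rightarrow> 'e \<Rightarrow> 'f" where
  "fderiv f x \<equiv> frechet_derivative f (at x)"

lemma has_derivative_fderiv:
  "f differentiable (at x) \<Longrightarrow> (f has_derivative fderiv f x) (at x)"
  by (simp add: frechet_derivative_works)

lemma has_derivative_imp_fderiv:
  "(f has_derivative f') (at x) \<Longrightarrow> fderiv f x = f'"
  by (rule frechet_derivative_at[symmetric])

text \<open>Both functions have the same derivatives at \<open>x\<close>, so the choice behind
  \<open>frechet_derivative\<close> returns the same map, even at points where no derivative
  exists.\<close>

lemma fderiv_cong_open:
  assumes "open W" "x \<in> W" "\<And>y. y \<in> W \<Longrightarrow> f y = g y"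
  shows "fderiv f x = fderiv g x"
proof -
  have "(f has_derivative D) (at x) \<longleftrightarrow> (g has_derivative D) (at x)" for D
    using has_derivative_transform_within_open[OF _ assms(1,2)] assms(3) by metis
  then show ?thesis by (simp add: frechet_derivative_def)
qed

lemma fderiv_left_inverse:
  assumes W: "open W" "x \<in> W" and f: "f differentiable (at x)" and g: "g differentiable (at (f x))"
    and inv: "\<And>y. y \<in> W \<Longrightarrow> g (f y) = y"
  shows "fderiv g (f x) (fderiv f x v) = v"
proof -
  have "((\<lambda>y. g (f y)) has_derivative (\<lambda>v. fderiv g (f x) (fderiv f x v))) (at x)"
    by (rule has_derivative_compose[OF has_derivative_fderiv[OF f] has_derivative_fderiv[OF g]])
  moreover have "((\<lambda>y. g (f y)) has_derivative (\<lambda>v. v)) (at x)"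
    by (rule has_derivative_transform_within_open[OF has_derivative_ident W]) (simp add: inv)
  ultimately show ?thesis by (rule fun_cong[OF has_derivative_unique])
qed

lemma C_k_on_2_iff:
  "C_k_on 2 S f \<longleftrightarrow> (\<forall>x\<in>S. f differentiable (at x)) \<and>
     (\<forall>v. (\<forall>x\<in>S. (\<lambda>y. fderiv f y v) differentiable (at x)) \<and>
       (\<forall>w. continuous_on S (\<lambda>x. fderiv (\<lambda>y. fderiv f y v) x w)))"
  by (simp add: numeral_2_eq_2)

lemma smooth_on_imp_C2: "smooth_on S f \<Longrightarrow> C_k_on 2 S f"
  by (simp add: smooth_on_def)

section \<open>Symmetry of second derivatives\<close>

lemma has_real_derivative_along_line:
  fixes f :: "'e::real_normed_vector \<Rightarrow> real"
  assumes "f differentiable (at (x + t *\<^sub>R v))"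
  shows "((\<lambda>t. f (x + t *\<^sub>R v)) has_real_derivative fderiv f (x + t *\<^sub>R v) v) (at t)"
proof -
  have "((\<lambda>t. x + t *\<^sub>R v) has_derivative (\<lambda>s. s *\<^sub>R v)) (at t)"
    by (auto intro!: derivative_eq_intros)
  from has_derivative_compose[OF this has_derivative_fderiv[OF assms]]
  show ?thesis
    by (simp add: has_field_derivative_def linear_cmul[OF linear_frechet_derivative[OF assms]]
        mult_commute_abs)
qed

text \<open>The mean value theorem is applied twice: along \<open>v\<close> to the difference
  between a translate of \<open>f\<close> and \<open>f\<close>, then along \<open>w\<close> to the
  \<open>v\<close>-derivative of \<open>f\<close>. The second difference on the left is symmetric in
  \<open>v\<close> and \<open>w\<close>, and this symmetry is what gets exploited next.\<close>

lemma second_difference_mean_value: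
  fixes f :: "'e::real_normed_vector \<Rightarrow> real"
  assumes f: "\<And>y. y \<in> ball x r \<Longrightarrow> f differentiable (at y)"
    and fv: "\<And>y. y \<in> ball x r \<Longrightarrow> (\<lambda>y. fderiv f y v) differentiable (at y)"
    and t: "t > 0" "t * (norm v + norm w) < r"
  shows "\<exists>p\<in>ball x r. f (x + t *\<^sub>R v + t *\<^sub>R w) - f (x + t *\<^sub>R v) - f (x + t *\<^sub>R w) + f x
           = t * (t * fderiv (\<lambda>y. fderiv f y v) p w)"
proof -
  \<comment> \<open>All points at which derivatives are taken lie in the parallelogram spanned by
    \<open>t\<close> times \<open>v\<close> and \<open>t\<close> times \<open>w\<close>, which fits
    into the ball.\<close>
  have ball: "x + a *\<^sub>R v + b *\<^sub>R w \<in> ball x r" if "0 \<le> a" "a \<le> t" "0 \<le> b" "b \<le> t" for a b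
  proof -
    have "norm (a *\<^sub>R v + b *\<^sub>R w) \<le> a * norm v + b * norm w"
      using norm_triangle_ineq[of "a *\<^sub>R v" "b *\<^sub>R w"] that by simp
    also have "\<dots> \<le> t * norm v + t * norm w"
      using that by (intro add_mono mult_right_mono) auto
    finally show ?thesis using t(2) norm_minus_cancel[of "a *\<^sub>R v + b *\<^sub>R w"]
      by (simp add: dist_norm algebra_simps)
  qed
  define g where "g a = f ((x + t *\<^sub>R w) + a *\<^sub>R v) - f (x + a *\<^sub>R v)" for a
  have "\<exists>z. 0 < z \<and> z < t \<and> g t - g 0
      = (t - 0) * (fderiv f ((x + t *\<^sub>R w) + z *\<^sub>R v) v - fderiv f (x + z *\<^sub>R v) v)"
  proof (rule MVT2[OF t(1)])
    fix a assume a: "0 \<le> a" "a \<le> t"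
    show "DERIV g a :> fderiv f ((x + t *\<^sub>R w) + a *\<^sub>R v) v - fderiv f (x + a *\<^sub>R v) v"
      unfolding g_def using ball[OF a, of t] ball[OF a, of 0] t(1)
      by (intro DERIV_diff has_real_derivative_along_line f) (auto simp: algebra_simps)
  qed
  then obtain z where z: "0 < z" "z < t"
    "g t - g 0 = t * (fderiv f ((x + t *\<^sub>R w) + z *\<^sub>R v) v - fderiv f (x + z *\<^sub>R v) v)"
    by auto
  have "\<exists>s. 0 < s \<and> s < t \<and> fderiv f ((x + z *\<^sub>R v) + t *\<^sub>R w) v - fderiv f ((x + z *\<^sub>R v) + 0 *\<^sub>R w) v
      = (t - 0) * fderiv (\<lambda>y. fderiv f y v) ((x + z *\<^sub>R v) + s *\<^sub>R w) w"
    by (rule MVT2[OF t(1)], rule has_real_derivative_along_line, rule fv) (use ball z in auto)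
  then obtain s where s: "0 < s" "s < t"
    "fderiv f ((x + z *\<^sub>R v) + t *\<^sub>R w) v - fderiv f (x + z *\<^sub>R v) v
      = t * fderiv (\<lambda>y. fderiv f y v) ((x + z *\<^sub>R v) + s *\<^sub>R w) w"
    by auto
  have "g t - g 0 = t * (t * fderiv (\<lambda>y. fderiv f y v) ((x + z *\<^sub>R v) + s *\<^sub>R w) w)"
    using z(3) s(3) by (simp add: algebra_simps)
  moreover have "(x + z *\<^sub>R v) + s *\<^sub>R w \<in> ball x r" using ball z s by auto
  ultimately show ?thesis unfolding g_def
    by (intro bexI[of _ "(x + z *\<^sub>R v) + s *\<^sub>R w"]) (auto simp: algebra_simps)
qed

text \<open>Exchanging \<open>v\<close> and \<open>w\<close> leaves the second difference unchanged,
  so the mixed derivative in one order at some \<open>p\<close> equals the one in the other order at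
  some \<open>q\<close>, with both points as close to \<open>x\<close> as desired. Continuity of the
  second derivatives at \<open>x\<close> does the rest.\<close>

lemma second_fderiv_symmetric_real:
  fixes f :: "'e::real_normed_vector \<Rightarrow> real"
  assumes "C_k_on 2 W f" "open W" "x \<in> W"
  shows "fderiv (\<lambda>y. fderiv f y v) x w = fderiv (\<lambda>y. fderiv f y w) x v"
proof -
  define P where "P v w p = fderiv (\<lambda>y. fderiv f y v) p w" for v w p
  have cont: "continuous (at x) (P v w)" for v w
    using assms unfolding P_def by (simp add: C_k_on_2_iff continuous_on_eq_continuous_at)
  have "\<bar>P v w x - P w v x\<bar> \<le> 0 + e" if "e > 0" for e
  proof -
    obtain r1 where r1: "r1 > 0" "\<And>p. p \<in> ball x r1 \<Longrightarrow> dist (P v w p) (P v w x) < e / 2"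
      using cont[of v w] \<open>e > 0\<close> unfolding continuous_at_ball
      by (metis half_gt_zero image_subset_iff mem_ball dist_commute)
    obtain r2 where r2: "r2 > 0" "\<And>p. p \<in> ball x r2 \<Longrightarrow> dist (P w v p) (P w v x) < e / 2"
      using cont[of w v] \<open>e > 0\<close> unfolding continuous_at_ball
      by (metis half_gt_zero image_subset_iff mem_ball dist_commute)
    obtain r0 where r0: "r0 > 0" "ball x r0 \<subseteq> W" using assms open_contains_ball by metis
    define r where "r = min r0 (min r1 r2)"
    \<comment> \<open>The summand 1 keeps the denominator positive when both directions
      vanish.\<close>
    define t where "t = r / (2 * (norm v + norm w + 1))"
    have "r > 0" using r0 r1 r2 by (simp add: r_def)
    have t: "t > 0" using \<open>r > 0\<close> by (simp add: t_def add_nonneg_pos)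
    have "t * (norm v + norm w) \<le> t * (norm v + norm w + 1)" using t by simp
    also have "t * (norm v + norm w + 1) = r / 2"
    proof -
      have "norm v + norm w + 1 \<noteq> 0" by (metis add_nonneg_pos norm_ge_zero add_nonneg_nonneg zero_less_one less_irrefl)
      then show ?thesis by (simp add: t_def field_simps)
    qed
    finally have tr: "t * (norm v + norm w) < r" using \<open>r > 0\<close> by simp
    have W: "y \<in> W" if "y \<in> ball x r" for y using r0 that by (auto simp: r_def)
    have d: "f differentiable (at y)" "(\<lambda>y. fderiv f y v) differentiable (at y)" if "y \<in> ball x r" for y v
      using W[OF that] assms(1) by (auto simp: C_k_on_2_iff)
    obtain p where p: "p \<in> ball x r" "f (x + t *\<^sub>R v + t *\<^sub>R w) - f (x + t *\<^sub>R v) - f (x + t *\<^sub>R w) + f x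
           = t * (t * P v w p)"
      using second_difference_mean_value[of x r f v t w] d t tr by (auto simp: P_def)
    obtain q where q: "q \<in> ball x r" "f (x + t *\<^sub>R w + t *\<^sub>R v) - f (x + t *\<^sub>R w) - f (x + t *\<^sub>R v) + f x
           = t * (t * P w v q)"
      using second_difference_mean_value[of x r f w t v] d t tr by (auto simp: P_def add.commute)
    have "t * (t * P v w p) = t * (t * P w v q)"
      using p(2) q(2) by (simp add: algebra_simps)
    then have "P v w p = P w v q" using t by simp
    moreover have "\<bar>P v w p - P v w x\<bar> < e / 2" "\<bar>P w v q - P w v x\<bar> < e / 2"
      using r1(2)[of p] r2(2)[of q] p(1) q(1) by (simp_all add: r_def dist_real_def)
    ultimately show ?thesis by linarith
  qed
  then have "\<bar>P v w x - P w v x\<bar> \<le> 0" by (rule field_le_epsilon)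
  then show ?thesis by (simp add: P_def)
qed

lemma fderiv_inner_left:
  fixes f :: "'e::real_normed_vector \<Rightarrow> 'f::real_inner"
  assumes "f differentiable (at x)"
  shows "fderiv (\<lambda>y. f y \<bullet> b) x = (\<lambda>v. fderiv f x v \<bullet> b)"
  by (rule has_derivative_imp_fderiv) (intro has_derivative_inner_left has_derivative_fderiv assms)

text \<open>Pairing with a fixed vector commutes with differentiation and reduces the claim to
  real-valued functions. This form is applied to the coordinate expression of the group
  isomorphism.\<close>

lemma second_fderiv_symmetric:
  fixes f :: "'e::real_normed_vector \<Rightarrow> 'f::real_inner"
  assumes f: "C_k_on 2 W f" and W: "open W" and x: "x \<in> W"
  shows "fderiv (\<lambda>y. fderiv f y v) x w = fderiv (\<lambda>y. fderiv f y w) x v"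
proof -
  have f1: "f differentiable (at y)" "(\<lambda>y. fderiv f y v) differentiable (at y)"
    and f2: "continuous_on W (\<lambda>y. fderiv (\<lambda>y. fderiv f y v) y w)" if "y \<in> W" for y v w
    using f that by (auto simp: C_k_on_2_iff)
  have inner2: "fderiv (\<lambda>y. fderiv (\<lambda>y. f y \<bullet> b) y v) y w = fderiv (\<lambda>y. fderiv f y v) y w \<bullet> b"
    if "y \<in> W" for b v w y
  proof -
    have "fderiv (\<lambda>y. fderiv (\<lambda>y. f y \<bullet> b) y v) y = fderiv (\<lambda>y. fderiv f y v \<bullet> b) y"
      by (rule fderiv_cong_open[OF W that]) (simp add: fderiv_inner_left f1)
    then show ?thesis using that by (simp add: fderiv_inner_left f1)
  qed
  have C2: "C_k_on 2 W (\<lambda>y. f y \<bullet> b)" for b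
    unfolding C_k_on_2_iff
  proof (intro conjI ballI allI)
    fix y assume y: "y \<in> W"
    show "(\<lambda>y. f y \<bullet> b) differentiable (at y)"
      using f1(1)[OF y] by (auto simp: differentiable_def intro: has_derivative_inner_left)
    fix v
    have "((\<lambda>y. fderiv f y v \<bullet> b) has_derivative (\<lambda>w. fderiv (\<lambda>y. fderiv f y v) y w \<bullet> b)) (at y)"
      by (intro has_derivative_inner_left has_derivative_fderiv f1 y)
    then have "((\<lambda>y. fderiv (\<lambda>y. f y \<bullet> b) y v) has_derivative (\<lambda>w. fderiv (\<lambda>y. fderiv f y v) y w \<bullet> b)) (at y)"
      by (rule has_derivative_transform_within_open[OF _ W y]) (simp add: fderiv_inner_left f1)
    then show "(\<lambda>y. fderiv (\<lambda>y. f y \<bullet> b) y v) differentiable (at y)"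
      by (auto simp: differentiable_def)
  next
    fix v w
    show "continuous_on W (\<lambda>y. fderiv (\<lambda>y. fderiv (\<lambda>y. f y \<bullet> b) y v) y w)"
      using f2[OF x, of v w] by (subst continuous_on_cong[OF refl inner2]) (auto intro: continuous_intros)
  qed
  \<comment> \<open>Pairing with the difference itself makes its squared norm vanish.\<close>
  let ?z = "fderiv (\<lambda>y. fderiv f y v) x w - fderiv (\<lambda>y. fderiv f y w) x v"
  have "?z \<bullet> ?z = 0"
    using second_fderiv_symmetric_real[OF C2 W x, of ?z v w] x
    by (simp add: inner2 inner_diff_left)
  then show ?thesis by simp
qed

text \<open>The first derivative vanishes at a maximum. A positive second derivative would make the
  derivative along \<open>v\<close> positive just beyond \<open>x\<close>, and \<open>f\<close>
  would exceed its maximum there.\<close>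

lemma second_fderiv_nonpos_at_max:
  fixes f :: "'e::real_normed_vector \<Rightarrow> real"
  assumes W: "open W" "x \<in> W" and f: "\<And>y. y \<in> W \<Longrightarrow> f differentiable (at y)"
    and fv: "(\<lambda>y. fderiv f y v) differentiable (at x)"
    and max: "\<And>y. y \<in> W \<Longrightarrow> f y \<le> f x"
  shows "fderiv (\<lambda>y. fderiv f y v) x v \<le> 0"
proof (rule ccontr)
  assume "\<not> ?thesis"
  then have pos: "0 < fderiv (\<lambda>y. fderiv f y v) x v" by simp
  have zero: "fderiv f x = (\<lambda>v. 0)"
    using differential_zero_maxmin[OF W(2,1) has_derivative_fderiv[OF f[OF W(2)]]] max by blast
  obtain d1 where d1: "d1 > 0" "\<And>t. 0 < t \<Longrightarrow> t < d1 \<Longrightarrow> fderiv f (x + t *\<^sub>R v) v > 0"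
    using has_real_derivative_pos_inc_right[OF _ pos, of "\<lambda>t. fderiv f (x + t *\<^sub>R v) v" 0 UNIV]
      has_real_derivative_along_line[of "\<lambda>y. fderiv f y v" x 0 v] fv zero by auto
  obtain r where r: "r > 0" "ball x r \<subseteq> W" using W open_contains_ball by metis
  \<comment> \<open>Small enough for the derivative along \<open>v\<close> to be positive before
    \<open>t\<close> and for the segment to stay in \<open>W\<close>.\<close>
  define t where "t = min (d1 / 2) (r / (2 * (norm v + 1)))"
  have nv: "norm v + 1 > 0" by (simp add: add_nonneg_pos)
  have t: "t > 0" "t < d1" using d1 r nv by (auto simp: t_def)
  have "t * (norm v + 1) \<le> r / 2"
  proof -
    have "t \<le> r / (2 * (norm v + 1))" by (simp add: t_def)
    then have "t * (norm v + 1) \<le> r / (2 * (norm v + 1)) * (norm v + 1)"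
      using nv by (intro mult_right_mono) auto
    also have "\<dots> = r / 2" using nv by (simp add: field_simps)
    finally show ?thesis .
  qed
  then have tr: "t * norm v < r" using r t by (simp add: algebra_simps)
  have inW: "x + s *\<^sub>R v \<in> W" if "0 \<le> s" "s \<le> t" for s
  proof -
    have "norm (s *\<^sub>R v) \<le> t * norm v" using that by (simp add: mult_right_mono)
    then show ?thesis using tr r(2) by (auto simp: dist_norm)
  qed
  have "\<exists>z. 0 < z \<and> z < t \<and> f (x + t *\<^sub>R v) - f (x + 0 *\<^sub>R v) = (t - 0) * fderiv f (x + z *\<^sub>R v) v"
    by (rule MVT2[OF t(1)]) (intro has_real_derivative_along_line f inW)
  then obtain z where z: "0 < z" "z < t" "f (x + t *\<^sub>R v) - f x = t * fderiv f (x + z *\<^sub>R v) v" by auto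
  then have "f (x + t *\<^sub>R v) - f x > 0" using d1(2)[of z] t by simp
  with max[OF inW, of t] t show False by simp
qed

text \<open>Expanding \<open>E y\<close> in \<open>Basis\<close> leaves finitely many ordinary
  products, so it is enough to differentiate \<open>L\<close> one vector at a time. This product
  rule serves for metrics and for differentials applied to vector fields.\<close>

lemma has_derivative_linear_family_apply:
  fixes L :: "'e::real_normed_vector \<Rightarrow> 'f::euclidean_space \<Rightarrow> 'g::real_normed_vector"
  assumes W: "open W" "x \<in> W" and lin: "\<And>y. y \<in> W \<Longrightarrow> linear (L y)"
    and L: "\<And>v. (\<lambda>y. L y v) differentiable (at x)"
    and E: "(E has_derivative E') (at x)"
  shows "((\<lambda>y. L y (E y)) has_derivative (\<lambda>v. L x (E' v) + fderiv (\<lambda>y. L y (E x)) x v)) (at x)"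
proof -
  have exp: "L y e = (\<Sum>b\<in>Basis. (e \<bullet> b) *\<^sub>R L y b)" if "y \<in> W" for y e
  proof -
    have "L y e = L y (\<Sum>b\<in>Basis. (e \<bullet> b) *\<^sub>R b)" by (simp add: euclidean_representation)
    also have "\<dots> = (\<Sum>b\<in>Basis. (e \<bullet> b) *\<^sub>R L y b)"
      using lin[OF that] by (simp add: linear_sum linear_cmul)
    finally show ?thesis .
  qed
  have D1: "((\<lambda>y. \<Sum>b\<in>Basis. (E y \<bullet> b) *\<^sub>R L y b) has_derivative
      (\<lambda>v. \<Sum>b\<in>Basis. (E x \<bullet> b) *\<^sub>R fderiv (\<lambda>y. L y b) x v + (E' v \<bullet> b) *\<^sub>R L x b)) (at x)"
    by (intro has_derivative_sum has_derivative_scaleR has_derivative_inner_left E has_derivative_fderiv L)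
  have D2: "((\<lambda>y. \<Sum>b\<in>Basis. (E x \<bullet> b) *\<^sub>R L y b) has_derivative
      (\<lambda>v. \<Sum>b\<in>Basis. (E x \<bullet> b) *\<^sub>R fderiv (\<lambda>y. L y b) x v)) (at x)"
    by (intro has_derivative_sum has_derivative_scaleR_right has_derivative_fderiv L)
  have "((\<lambda>y. L y (E x)) has_derivative
      (\<lambda>v. \<Sum>b\<in>Basis. (E x \<bullet> b) *\<^sub>R fderiv (\<lambda>y. L y b) x v)) (at x)"
    by (rule has_derivative_transform_within_open[OF D2 W]) (simp add: exp[symmetric])
  note eq = has_derivative_imp_fderiv[OF this]
  have "((\<lambda>y. L y (E y)) has_derivative
      (\<lambda>v. \<Sum>b\<in>Basis. (E x \<bullet> b) *\<^sub>R fderiv (\<lambda>y. L y b) x v + (E' v \<bullet> b) *\<^sub>R L x b)) (at x)"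
    by (rule has_derivative_transform_within_open[OF D1 W]) (simp add: exp[symmetric])
  then show ?thesis
    by (simp add: eq sum.distrib exp[OF W(2), of "E' _"] add.commute)
qed

lemma linear_fderiv_family:
  assumes W: "open W" "x \<in> W" and lin: "\<And>y. y \<in> W \<Longrightarrow> linear (L y)"
    and L: "\<And>v. (\<lambda>y. L y v) differentiable (at x)"
  shows "linear (\<lambda>v. fderiv (\<lambda>y. L y v) x w)"
proof (rule linearI)
  fix a b and c :: real
  have "((\<lambda>y. L y a + L y b) has_derivative (\<lambda>w. fderiv (\<lambda>y. L y a) x w + fderiv (\<lambda>y. L y b) x w)) (at x)"
    by (intro has_derivative_add has_derivative_fderiv L)
  then have "((\<lambda>y. L y (a + b)) has_derivative (\<lambda>w. fderiv (\<lambda>y. L y a) x w + fderiv (\<lambda>y. L y b) x w)) (at x)"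
    by (rule has_derivative_transform_within_open[OF _ W]) (simp add: linear_add lin)
  then show "fderiv (\<lambda>y. L y (a + b)) x w = fderiv (\<lambda>y. L y a) x w + fderiv (\<lambda>y. L y b) x w"
    by (simp add: has_derivative_imp_fderiv)
  have "((\<lambda>y. c *\<^sub>R L y a) has_derivative (\<lambda>w. c *\<^sub>R fderiv (\<lambda>y. L y a) x w)) (at x)"
    by (intro has_derivative_scaleR_right has_derivative_fderiv L)
  then have "((\<lambda>y. L y (c *\<^sub>R a)) has_derivative (\<lambda>w. c *\<^sub>R fderiv (\<lambda>y. L y a) x w)) (at x)"
    by (rule has_derivative_transform_within_open[OF _ W]) (simp add: linear_cmul lin)
  then show "fderiv (\<lambda>y. L y (c *\<^sub>R a)) x w = c *\<^sub>R fderiv (\<lambda>y. L y a) x w"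
    by (simp add: has_derivative_imp_fderiv)
qed


section \<open>The Laplacian in an orthonormal frame\<close>

text \<open>\<open>frame_expansion\<close> says that the frame spans, and it is the source of
  nondegeneracy: inner products with the frame determine a vector.\<close>

locale orthonormal_frame =
  fixes U :: "'e::euclidean_space set" and \<gamma> :: "'e \<Rightarrow> 'e \<Rightarrow> 'e \<Rightarrow> real"
    and I :: "'i set" and E :: "'i \<Rightarrow> 'e \<Rightarrow> 'e"
  assumes open_U: "open U"
    and bilinear_metric: "x \<in> U \<Longrightarrow> bilinear (\<gamma> x)"
    and metric_sym: "x \<in> U \<Longrightarrow> \<gamma> x v w = \<gamma> x w v"
    and metric_differentiable: "x \<in> U \<Longrightarrow> (\<lambda>y. \<gamma> y v w) differentiable (at x)"
    and frame_differentiable: "i \<in> I \<Longrightarrow> x \<in> U \<Longrightarrow> E i differentiable (at x)"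
    and orthonormal: "x \<in> U \<Longrightarrow> i \<in> I \<Longrightarrow> j \<in> I \<Longrightarrow> \<gamma> x (E i x) (E j x) = (if i = j then 1 else 0)"
    and frame_expansion: "x \<in> U \<Longrightarrow> (\<Sum>i\<in>I. \<gamma> x v (E i x) *\<^sub>R E i x) = v"
begin

section \<open>Linear forms and their representing vectors\<close>

lemma metric_linear_right: "x \<in> U \<Longrightarrow> linear (\<gamma> x v)"
  and metric_linear_left: "x \<in> U \<Longrightarrow> linear (\<lambda>v. \<gamma> x v w)"
  using bilinear_metric by (auto simp: bilinear_def)

lemma metric_eq_cancel:
  assumes "x \<in> U" "\<And>k. \<gamma> x v k = \<gamma> x w k" shows "v = w"
proof -
  have "v = (\<Sum>i\<in>I. \<gamma> x v (E i x) *\<^sub>R E i x)" by (rule frame_expansion[OF assms(1), symmetric])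
  also have "\<dots> = (\<Sum>i\<in>I. \<gamma> x w (E i x) *\<^sub>R E i x)" by (simp only: assms(2))
  also have "\<dots> = w" by (rule frame_expansion[OF assms(1)])
  finally show ?thesis .
qed

text \<open>By symmetry of the metric the coefficients become those of \<open>k\<close>, and
  linearity of \<open>l\<close> reassembles \<open>k\<close> from its expansion: an explicit Riesz
  representation.\<close>

lemma metric_representer:
  assumes "x \<in> U" "linear l"
  shows "\<gamma> x (\<Sum>i\<in>I. l (E i x) *\<^sub>R E i x) k = l k"
proof -
  have "\<gamma> x (\<Sum>i\<in>I. l (E i x) *\<^sub>R E i x) k = (\<Sum>i\<in>I. l (E i x) * \<gamma> x (E i x) k)"
    by (simp add: linear_sum[OF metric_linear_left[OF assms(1)]] linear_cmul[OF metric_linear_left[OF assms(1)]])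
  also have "\<dots> = l (\<Sum>i\<in>I. \<gamma> x k (E i x) *\<^sub>R E i x)"
    by (simp add: linear_sum[OF assms(2)] linear_cmul[OF assms(2)] metric_sym[OF assms(1), of k] mult.commute)
  finally show ?thesis by (simp add: frame_expansion assms)
qed

text \<open>This resolves the definite descriptions in both \<open>gradient\<close> and
  \<open>christoffel\<close>.\<close>

lemma the_representer:
  assumes "x \<in> U" "linear l"
  shows "(THE X. \<forall>w. \<gamma> x X w = l w) = (\<Sum>i\<in>I. l (E i x) *\<^sub>R E i x)"
proof (rule the_equality)
  show "\<forall>w. \<gamma> x (\<Sum>i\<in>I. l (E i x) *\<^sub>R E i x) w = l w"
    by (simp add: metric_representer assms)
  then show "X = (\<Sum>i\<in>I. l (E i x) *\<^sub>R E i x)" if "\<forall>w. \<gamma> x X w = l w" for X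
    using that by (intro metric_eq_cancel[OF assms(1)]) simp
qed

lemma gradient_frame:
  assumes "x \<in> U" "u differentiable (at x)"
  shows "gradient \<gamma> u x = (\<Sum>i\<in>I. fderiv u x (E i x) *\<^sub>R E i x)"
  unfolding gradient_def by (rule the_representer[OF assms(1) linear_frechet_derivative[OF assms(2)]])

text \<open>The right-hand side of the Koszul formula for constant coordinate fields, whose brackets
  vanish; in index notation, the Christoffel symbols of the first kind.\<close>

definition koszul :: "'e \<Rightarrow> 'e \<Rightarrow> 'e \<Rightarrow> 'e \<Rightarrow> real" where
  "koszul x v w k = (fderiv (\<lambda>y. \<gamma> y w k) x v + fderiv (\<lambda>y. \<gamma> y v k) x w - fderiv (\<lambda>y. \<gamma> y v w) x k) / 2"

lemma linear_fderiv_metric: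
  assumes "x \<in> U"
  shows "linear (fderiv (\<lambda>y. \<gamma> y v w) x)" "linear (\<lambda>v. fderiv (\<lambda>y. \<gamma> y v w) x k)"
    "linear (\<lambda>w. fderiv (\<lambda>y. \<gamma> y v w) x k)"
proof -
  show "linear (fderiv (\<lambda>y. \<gamma> y v w) x)"
    by (intro linear_frechet_derivative metric_differentiable assms)
  show "linear (\<lambda>v. fderiv (\<lambda>y. \<gamma> y v w) x k)"
    by (rule linear_fderiv_family[OF open_U assms metric_linear_left metric_differentiable[OF assms]])
  show "linear (\<lambda>w. fderiv (\<lambda>y. \<gamma> y v w) x k)"
    by (rule linear_fderiv_family[OF open_U assms metric_linear_right metric_differentiable[OF assms]])
qed

lemma linear_koszul:
  assumes "x \<in> U"
  shows "linear (koszul x v w)" "linear (\<lambda>w. koszul x v w k)" "linear (\<lambda>v. koszul x v w k)"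
proof -
  have half: "linear f \<Longrightarrow> linear (\<lambda>x. f x / 2)" for f :: "'e \<Rightarrow> real"
    by (rule linearI) (simp_all add: linear_add linear_cmul add_divide_distrib)
  show "linear (koszul x v w)" "linear (\<lambda>w. koszul x v w k)" "linear (\<lambda>v. koszul x v w k)"
    unfolding koszul_def
    by (rule half, intro linear_compose_add linear_compose_sub linear_fderiv_metric[OF assms])+
qed

lemma christoffel_frame:
  assumes "x \<in> U"
  shows "christoffel \<gamma> x v w = (\<Sum>i\<in>I. koszul x v w (E i x) *\<^sub>R E i x)"
  unfolding christoffel_def koszul_def[symmetric] by (rule the_representer[OF assms linear_koszul(1)[OF assms]])

lemma metric_christoffel:
  assumes "x \<in> U"
  shows "\<gamma> x (christoffel \<gamma> x v w) k = koszul x v w k"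
  by (simp add: christoffel_frame metric_representer assms linear_koszul)

lemma linear_christoffel:
  assumes "x \<in> U"
  shows "linear (christoffel \<gamma> x v)" "linear (\<lambda>v. christoffel \<gamma> x v w)"
proof -
  have scale: "linear f \<Longrightarrow> linear (\<lambda>v. f v *\<^sub>R a)" for f :: "'e \<Rightarrow> real" and a :: 'e
    by (rule linearI) (simp_all add: linear_add linear_cmul scaleR_add_left)
  show "linear (christoffel \<gamma> x v)" "linear (\<lambda>v. christoffel \<gamma> x v w)"
    unfolding christoffel_frame[OF assms]
    by (intro linear_compose_sum ballI scale linear_koszul[OF assms])+
qed

text \<open>A trace may be computed in any basis: \<open>L b\<close> is expanded in the frame, the
  sums are exchanged, and the frame vectors are reassembled from \<open>Basis\<close>.\<close>

lemma trace_frame: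
  assumes "x \<in> U" "linear L"
  shows "(\<Sum>b\<in>Basis. L b \<bullet> b) = (\<Sum>i\<in>I. \<gamma> x (L (E i x)) (E i x))"
proof -
  have "(\<Sum>b\<in>Basis. L b \<bullet> b) = (\<Sum>b\<in>Basis. (\<Sum>i\<in>I. \<gamma> x (L b) (E i x) *\<^sub>R E i x) \<bullet> b)"
    by (simp add: frame_expansion assms)
  also have "\<dots> = (\<Sum>i\<in>I. \<Sum>b\<in>Basis. \<gamma> x (L b) (E i x) * (E i x \<bullet> b))"
    by (subst sum.swap) (simp add: inner_sum_left)
  also have "\<dots> = (\<Sum>i\<in>I. \<gamma> x (L (\<Sum>b\<in>Basis. (E i x \<bullet> b) *\<^sub>R b)) (E i x))"
    by (simp add: linear_sum[OF assms(2)] linear_cmul[OF assms(2)] mult.commute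
        linear_sum[OF metric_linear_left[OF assms(1)]] linear_cmul[OF metric_linear_left[OF assms(1)]])
  finally show ?thesis by (simp add: euclidean_representation)
qed

text \<open>The Christoffel term of the divergence is removed by differentiating \<open>\<gamma>(E\<^sub>j, E\<^sub>j) = 1\<close> along \<open>E\<^sub>i\<close>.\<close>

lemma divergence_frame_field:
  assumes x: "x \<in> U" and i: "i \<in> I"
  shows "divergence \<gamma> (E i) x =
    (\<Sum>j\<in>I. \<gamma> x (fderiv (E i) x (E j x) - fderiv (E j) x (E i x)) (E j x))"
proof -
  have L: "linear (\<lambda>v. fderiv (E i) x v + christoffel \<gamma> x v (E i x))"
    by (intro linear_compose_add linear_frechet_derivative frame_differentiable i x linear_christoffel)
  have "divergence \<gamma> (E i) x =
      (\<Sum>j\<in>I. \<gamma> x (fderiv (E i) x (E j x) + christoffel \<gamma> x (E j x) (E i x)) (E j x))"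
    unfolding divergence_def by (rule trace_frame[OF x L])
  also have "\<dots> = (\<Sum>j\<in>I. \<gamma> x (fderiv (E i) x (E j x) - fderiv (E j) x (E i x)) (E j x))"
  proof (rule sum.cong[OF refl])
    fix j assume j: "j \<in> I"
    let ?v = "E j x"
    have dj: "(E j has_derivative fderiv (E j) x) (at x)"
      by (intro has_derivative_fderiv frame_differentiable j x)
    \<comment> \<open>The point \<open>y\<close> enters \<open>\<gamma> y (E j y) (E j y)\<close> in
      three places, so the product rule is used twice: here for the right argument with the left one
      frozen, in \<open>A\<close> for the left argument.\<close>
    have d1: "((\<lambda>y. \<gamma> y ?v (E j y)) has_derivative (\<lambda>w. \<gamma> x ?v (fderiv (E j) x w) + fderiv (\<lambda>y. \<gamma> y ?v ?v) x w)) (at x)"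
      by (rule has_derivative_linear_family_apply[where L = "\<lambda>y. \<gamma> y ?v", OF open_U x metric_linear_right metric_differentiable[OF x] dj])
    have d1': "(\<lambda>y. \<gamma> y v (E j y)) differentiable (at x)" for v
      using has_derivative_linear_family_apply[where L = "\<lambda>y. \<gamma> y v", OF open_U x metric_linear_right metric_differentiable[OF x] dj]
      by (auto simp: differentiable_def)
    have A: "((\<lambda>y. \<gamma> y (E j y) (E j y)) has_derivative
        (\<lambda>w. \<gamma> x (fderiv (E j) x w) ?v + fderiv (\<lambda>y. \<gamma> y ?v (E j y)) x w)) (at x)"
      by (rule has_derivative_linear_family_apply[where L = "\<lambda>y v. \<gamma> y v (E j y)", OF open_U x metric_linear_left d1' dj])
    have B: "((\<lambda>y. \<gamma> y (E j y) (E j y)) has_derivative (\<lambda>w. 0)) (at x)"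
      by (rule has_derivative_transform_within_open[OF has_derivative_const open_U x, of 1])
        (simp add: orthonormal j)
    have "\<gamma> x (fderiv (E j) x w) ?v + fderiv (\<lambda>y. \<gamma> y ?v (E j y)) x w = 0" for w
      by (rule fun_cong[OF has_derivative_unique[OF A B]])
    then have "2 * \<gamma> x (fderiv (E j) x (E i x)) ?v + fderiv (\<lambda>y. \<gamma> y ?v ?v) x (E i x) = 0"
      by (simp add: has_derivative_imp_fderiv[OF d1] metric_sym[OF x, of ?v])
    moreover have "\<gamma> x (christoffel \<gamma> x ?v (E i x)) ?v = fderiv (\<lambda>y. \<gamma> y ?v ?v) x (E i x) / 2"
    proof -
      \<comment> \<open>With \<open>?v\<close> as first and last argument of \<open>koszul\<close>,
        symmetry of the metric cancels the first term against the third.\<close>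
      have "fderiv (\<lambda>y. \<gamma> y ?v (E i x)) x = fderiv (\<lambda>y. \<gamma> y (E i x) ?v) x"
        by (rule fderiv_cong_open[OF open_U x]) (rule metric_sym)
      then show ?thesis by (simp add: metric_christoffel x koszul_def)
    qed
    ultimately show "\<gamma> x (fderiv (E i) x ?v + christoffel \<gamma> x ?v (E i x)) ?v
        = \<gamma> x (fderiv (E i) x ?v - fderiv (E j) x (E i x)) ?v"
      by (simp add: linear_add[OF metric_linear_left[OF x]] linear_diff[OF metric_linear_left[OF x]])
  qed
  finally show ?thesis .
qed

text \<open>The gradient is the sum of the \<open>E i\<close> weighted by the derivatives of
  \<open>u\<close> along them, and the divergence of a function times a field is the derivative of
  the function along the field plus the function times the divergence of the field.\<close>

lemma laplacian_frame:
  assumes W: "open W" "W \<subseteq> U" "x \<in> W"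
    and u: "\<And>y. y \<in> W \<Longrightarrow> u differentiable (at y)" "\<And>v. (\<lambda>y. fderiv u y v) differentiable (at x)"
  shows "laplacian \<gamma> u x =
    (\<Sum>i\<in>I. fderiv (\<lambda>y. fderiv u y (E i y)) x (E i x) + fderiv u x (E i x) * divergence \<gamma> (E i) x)"
proof -
  have x: "x \<in> U" using W by auto
  define f where "f = (\<lambda>i y. fderiv u y (E i y))"
  have dE: "(E i has_derivative fderiv (E i) x) (at x)" if "i \<in> I" for i
    by (intro has_derivative_fderiv frame_differentiable that x)
  have f: "(f i has_derivative fderiv (f i) x) (at x)" if "i \<in> I" for i
    using has_derivative_linear_family_apply[where L = "fderiv u", OF W(1,3) linear_frechet_derivative[OF u(1)] u(2) dE[OF that]]
    unfolding f_def by (auto simp: differentiable_def intro!: has_derivative_fderiv)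
  have "((\<lambda>y. \<Sum>i\<in>I. f i y *\<^sub>R E i y) has_derivative
      (\<lambda>v. \<Sum>i\<in>I. f i x *\<^sub>R fderiv (E i) x v + fderiv (f i) x v *\<^sub>R E i x)) (at x)"
    by (intro has_derivative_sum has_derivative_scaleR f dE)
  then have "(gradient \<gamma> u has_derivative
      (\<lambda>v. \<Sum>i\<in>I. f i x *\<^sub>R fderiv (E i) x v + fderiv (f i) x v *\<^sub>R E i x)) (at x)"
    by (rule has_derivative_transform_within_open[OF _ W(1,3)]) (use W in \<open>auto simp: gradient_frame u f_def\<close>)
  then have D: "fderiv (gradient \<gamma> u) x =
      (\<lambda>v. \<Sum>i\<in>I. f i x *\<^sub>R fderiv (E i) x v + fderiv (f i) x v *\<^sub>R E i x)"
    by (rule has_derivative_imp_fderiv)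
  have grad: "gradient \<gamma> u x = (\<Sum>i\<in>I. f i x *\<^sub>R E i x)"
    by (simp add: gradient_frame x u W f_def)
  have "laplacian \<gamma> u x = (\<Sum>b\<in>Basis. \<Sum>i\<in>I.
      fderiv (f i) x b * (E i x \<bullet> b) + f i x * ((fderiv (E i) x b + christoffel \<gamma> x b (E i x)) \<bullet> b))"
    unfolding laplacian_def divergence_def D grad
    by (intro sum.cong[OF refl])
      (simp add: linear_sum[OF linear_christoffel(1)[OF x]] linear_cmul[OF linear_christoffel(1)[OF x]]
        inner_add_left inner_sum_left sum.distrib algebra_simps)
  also have "\<dots> = (\<Sum>i\<in>I. (\<Sum>b\<in>Basis. fderiv (f i) x b * (E i x \<bullet> b)) + f i x * divergence \<gamma> (E i) x)"
    by (subst sum.swap) (simp add: sum.distrib divergence_def sum_distrib_left)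
  also have "\<dots> = (\<Sum>i\<in>I. fderiv (f i) x (E i x) + f i x * divergence \<gamma> (E i) x)"
  proof (rule sum.cong[OF refl], rule arg_cong2[where f = "(+)", OF _ refl])
    fix i assume i: "i \<in> I"
    have lin: "linear (fderiv (f i) x)" using f[OF i] by (rule has_derivative_linear)
    have "fderiv (f i) x (E i x) = fderiv (f i) x (\<Sum>b\<in>Basis. (E i x \<bullet> b) *\<^sub>R b)"
      by (simp add: euclidean_representation)
    then show "(\<Sum>b\<in>Basis. fderiv (f i) x b * (E i x \<bullet> b)) = fderiv (f i) x (E i x)"
      by (simp add: linear_sum[OF lin] linear_cmul[OF lin] mult.commute)
  qed
  finally show ?thesis by (simp add: f_def)
qed

end


section \<open>Left-invariant frames on \<open>Sol\<^sub>3\<close>\<close>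

text \<open>The left-invariant field on \<open>Sol3\<close> whose value at the identity is
  \<open>a\<close>; the invariance is checked in
  \<open>fderiv_sol_translation_sol_field\<close>.\<close>

definition sol_field :: "real \<times> real \<times> real \<Rightarrow> real \<times> real \<times> real \<Rightarrow> real \<times> real \<times> real" where
  "sol_field a p = (fst a * exp (snd (snd p)), fst (snd a) * exp (- snd (snd p)), snd (snd a))"

text \<open>The Lie algebra bracket of \<open>Sol3\<close> with its arguments exchanged:
  \<open>sol_bracket a b\<close> corresponds to the commutator of the field of \<open>b\<close> with
  that of \<open>a\<close>. The sign matches the difference occurring in
  \<open>divergence_frame_field\<close>.\<close>

definition sol_bracket :: "real \<times> real \<times> real \<Rightarrow> real \<times> real \<times> real \<Rightarrow> real \<times> real \<times> real" where
  "sol_bracket a b = (fst a * snd (snd b) - fst b * snd (snd a),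
     snd (snd a) * fst (snd b) - snd (snd b) * fst (snd a), 0)"

lemma linear_sol_field: "linear (\<lambda>a. sol_field a p)"
  by (rule linearI) (simp_all add: sol_field_def algebra_simps)

lemma sol_field_onto: "\<exists>a. sol_field a p = v"
  by (rule exI[of _ "(fst v * exp (- snd (snd p)), fst (snd v) * exp (snd (snd p)), snd (snd v))"])
    (simp add: sol_field_def mult.assoc flip: exp_add)

lemma sol_field_zero [simp]: "sol_field a 0 = a"
  by (simp add: sol_field_def zero_prod_def)

lemma has_derivative_sol_field:
  "(sol_field a has_derivative
     (\<lambda>v. (fst a * exp (snd (snd p)) * snd (snd v), - fst (snd a) * exp (- snd (snd p)) * snd (snd v), 0))) (at p)"
  unfolding sol_field_def[abs_def]
  by (auto intro!: derivative_eq_intros simp: fun_eq_iff)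

lemma sol_field_bracket:
  "fderiv (sol_field a) p (sol_field b p) - fderiv (sol_field b) p (sol_field a p) = sol_field (sol_bracket a b) p"
  by (simp add: has_derivative_imp_fderiv[OF has_derivative_sol_field])
    (simp add: sol_field_def sol_bracket_def algebra_simps)

text \<open>An orthonormal basis of the Lie algebra in the triangular shape that Gram-Schmidt yields
  when started with the \<open>y\<close>-direction; the Greek letters stand for the
  \<open>x\<close>-, \<open>y\<close>- and \<open>z\<close>-components. The corrections along
  \<open>y\<close> are then invisible to functions of \<open>x\<close> and \<open>z\<close>, which
  are the only ones used for the potential.\<close>

locale sol_basis =
  fixes m :: "real \<times> real \<times> real \<Rightarrow> real \<times> real \<times> real \<Rightarrow> real"
    and \<alpha>\<^sub>2 \<alpha>\<^sub>3 \<beta>\<^sub>1 \<beta>\<^sub>2 \<beta>\<^sub>3 \<delta>\<^sub>3 :: real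
    and e1 e2 e3
  assumes bilinear_m: "bilinear m" and m_sym: "m v w = m w v"
    and e1_def: "e1 = (0, \<beta>\<^sub>1, 0)" and e2_def: "e2 = (\<alpha>\<^sub>2, \<beta>\<^sub>2, 0)" and e3_def: "e3 = (\<alpha>\<^sub>3, \<beta>\<^sub>3, \<delta>\<^sub>3)"
    and nonzero: "\<beta>\<^sub>1 \<noteq> 0" "\<alpha>\<^sub>2 \<noteq> 0" "\<delta>\<^sub>3 \<noteq> 0"
    and unit: "m e1 e1 = 1" "m e2 e2 = 1" "m e3 e3 = 1"
    and orth: "m e1 e2 = 0" "m e1 e3 = 0" "m e2 e3 = 0"
begin

section \<open>Coefficients and adjoint traces in the triangular basis\<close>

lemmas m_simps = bilinear_ladd[OF bilinear_m] bilinear_radd[OF bilinear_m] bilinear_lmul[OF bilinear_m]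
  bilinear_rmul[OF bilinear_m] bilinear_lsub[OF bilinear_m] bilinear_rsub[OF bilinear_m]
  bilinear_lneg[OF bilinear_m] bilinear_rneg[OF bilinear_m] bilinear_lzero[OF bilinear_m] bilinear_rzero[OF bilinear_m]

lemma orth': "m e2 e1 = 0" "m e3 e1 = 0" "m e3 e2 = 0"
  using orth m_sym by metis+

lemma distinct_basis: "e1 \<noteq> e2" "e1 \<noteq> e3" "e2 \<noteq> e3"
  using nonzero by (auto simp: e1_def e2_def e3_def)

lemma basis_orthonormal:
  "i \<in> {e1, e2, e3} \<Longrightarrow> j \<in> {e1, e2, e3} \<Longrightarrow> m i j = (if i = j then 1 else 0)"
  using unit orth orth' distinct_basis by auto

lemma basis_expansion: "(\<Sum>i\<in>{e1, e2, e3}. m a i *\<^sub>R i) = a"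
proof -
  obtain x y z where a: "a = (x, y, z)" by (cases a)
  \<comment> \<open>Back substitution in the triangular system finds the coefficients, and
    orthonormality identifies them with the inner products.\<close>
  define c3 where "c3 = z / \<delta>\<^sub>3"
  define c2 where "c2 = (x - c3 * \<alpha>\<^sub>3) / \<alpha>\<^sub>2"
  define c1 where "c1 = (y - c3 * \<beta>\<^sub>3 - c2 * \<beta>\<^sub>2) / \<beta>\<^sub>1"
  have a': "a = c1 *\<^sub>R e1 + c2 *\<^sub>R e2 + c3 *\<^sub>R e3"
    using nonzero by (simp add: a e1_def e2_def e3_def c1_def c2_def c3_def)
  have "m a e1 = c1" "m a e2 = c2" "m a e3 = c3"
    by (simp_all add: a' m_simps unit orth orth')
  then show ?thesis using a' distinct_basis by (simp add: add.assoc)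
qed

text \<open>This is the unimodularity of \<open>Sol\<^sub>3\<close>.\<close>

lemma trace_ad:
  assumes "i \<in> {e1, e2, e3}"
  shows "(\<Sum>j\<in>{e1, e2, e3}. m (sol_bracket i j) j) = 0"
proof -
  \<comment> \<open>Nonzero summands arise only for \<open>i = e3\<close>: they are
    \<open>\<delta>\<^sub>3\<close> and its negative, because \<open>Sol3\<close> expands one
    direction of the plane at the rate at which it contracts the other. The remaining multiples of
    \<open>e1\<close> are paired with vectors orthogonal to it.\<close>
  have b: "sol_bracket e1 e1 = 0" "sol_bracket e2 e2 = 0" "sol_bracket e3 e3 = 0"
    "sol_bracket e1 e2 = 0" "sol_bracket e2 e1 = 0"
    "sol_bracket e1 e3 = (- \<delta>\<^sub>3) *\<^sub>R e1" "sol_bracket e3 e1 = \<delta>\<^sub>3 *\<^sub>R e1"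
    "sol_bracket e2 e3 = \<delta>\<^sub>3 *\<^sub>R e2 - (2 * \<beta>\<^sub>2 * \<delta>\<^sub>3 / \<beta>\<^sub>1) *\<^sub>R e1"
    "sol_bracket e3 e2 = (2 * \<beta>\<^sub>2 * \<delta>\<^sub>3 / \<beta>\<^sub>1) *\<^sub>R e1 - \<delta>\<^sub>3 *\<^sub>R e2"
    using nonzero by (simp_all add: sol_bracket_def e1_def e2_def e3_def zero_prod_def)
  have s: "(\<Sum>j\<in>{e1, e2, e3}. m (sol_bracket i j) j)
      = m (sol_bracket i e1) e1 + m (sol_bracket i e2) e2 + m (sol_bracket i e3) e3"
    using distinct_basis by simp
  show ?thesis
    unfolding s using assms by (auto simp: b m_simps unit orth orth')
qed

end


section \<open>A strictly superharmonic potential\<close>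

text \<open>For nonnegative \<open>s\<close> and \<open>w = exp z\<close>, the terms after 1 form
  the squared distance from the origin of a point with coordinate
  \<open>sqrt s * (x - b * w)\<close> along an axis and distance \<open>w\<close> from that axis.
  The summand 1 bounds the potential and makes its superharmonicity strict.\<close>

definition sol_quadratic :: "real \<Rightarrow> real \<Rightarrow> real \<times> real \<times> real \<Rightarrow> real" where
  "sol_quadratic s b p = 1 + s * (fst p - b * exp (snd (snd p)))\<^sup>2 + (exp (snd (snd p)))\<^sup>2"

definition sol_potential :: "real \<Rightarrow> real \<Rightarrow> real \<times> real \<times> real \<Rightarrow> real" where
  "sol_potential s b p = inverse (sqrt (sol_quadratic s b p))"

section \<open>Positivity and derivatives of the potential\<close>

lemma sol_quadratic_pos: "s \<ge> 0 \<Longrightarrow> sol_quadratic s b p > 0"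
  unfolding sol_quadratic_def by (intro add_pos_nonneg) auto

lemma sol_potential_pos: "s \<ge> 0 \<Longrightarrow> sol_potential s b p > 0"
  by (simp add: sol_potential_def sol_quadratic_pos)

lemma has_derivative_sol_quadratic:
  "(sol_quadratic s b has_derivative (\<lambda>v. 2 * (s * (fst p - b * exp (snd (snd p))) * (fst v - b * exp (snd (snd p)) * snd (snd v))
      + (exp (snd (snd p)))\<^sup>2 * snd (snd v)))) (at p)"
  unfolding sol_quadratic_def[abs_def]
  by (auto intro!: derivative_eq_intros simp: fun_eq_iff algebra_simps power2_eq_square)

lemma has_derivative_inverse_sqrt:
  fixes f :: "'e::real_normed_vector \<Rightarrow> real"
  assumes "(f has_derivative f') (at x)" "f x > 0"
  shows "((\<lambda>y. inverse (sqrt (f y))) has_derivative (\<lambda>v. - (inverse (sqrt (f x)) ^ 3) * (f' v / 2))) (at x)"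
proof -
  have "((\<lambda>y. inverse (sqrt (f y))) has_derivative
      (\<lambda>v. - (inverse (sqrt (f x)) * (f' v * (inverse (sqrt (f x)) / 2)) * inverse (sqrt (f x))))) (at x)"
    using assms(2)
    by (intro Deriv.has_derivative_inverse DERIV_compose_FDERIV[OF DERIV_real_sqrt] assms) auto
  then show ?thesis by (simp add: power3_eq_cube mult_ac)
qed

lemma has_derivative_sol_potential:
  assumes "s \<ge> 0"
  shows "(sol_potential s b has_derivative (\<lambda>v. - (sol_potential s b p ^ 3) *
    (s * (fst p - b * exp (snd (snd p))) * (fst v - b * exp (snd (snd p)) * snd (snd v))
      + (exp (snd (snd p)))\<^sup>2 * snd (snd v)))) (at p)"
  using has_derivative_inverse_sqrt[OF has_derivative_sol_quadratic sol_quadratic_pos[OF assms]]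
  unfolding sol_potential_def[abs_def] by (simp del: distrib_left_numeral)

lemma sol_potential_differentiable: "s \<ge> 0 \<Longrightarrow> sol_potential s b differentiable (at p)"
  unfolding differentiable_def by (rule exI, rule has_derivative_sol_potential)

lemma fderiv_sol_potential_differentiable:
  assumes "s \<ge> 0"
  shows "(\<lambda>p. fderiv (sol_potential s b) p v) differentiable (at p)"
proof -
  have e: "(\<lambda>p::real \<times> real \<times> real. exp (snd (snd p))) differentiable (at p)"
    unfolding differentiable_def
    by (rule exI, rule has_derivative_exp, rule bounded_linear_imp_has_derivative)
      (rule bounded_linear_compose[OF bounded_linear_snd bounded_linear_snd])
  have f: "fst differentiable (at p)"
    by (rule bounded_linear_imp_differentiable[OF bounded_linear_fst])
  show ?thesis
    unfolding has_derivative_imp_fderiv[OF has_derivative_sol_potential[OF assms]]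
      power3_eq_cube power2_eq_square
    by (intro differentiable_minus differentiable_mult differentiable_add differentiable_diff
        differentiable_const e f sol_potential_differentiable assms)
qed

lemma sol_field_sol_potential:
  assumes "s \<ge> 0"
  shows "fderiv (sol_potential s b) p (sol_field a p) = - (sol_potential s b p ^ 3) *
    (s * (fst a - b * snd (snd a)) * (fst p - b * exp (snd (snd p))) * exp (snd (snd p)) + snd (snd a) * (exp (snd (snd p)))\<^sup>2)"
  by (simp add: has_derivative_imp_fderiv[OF has_derivative_sol_potential[OF assms]])
    (simp add: sol_field_def algebra_simps power2_eq_square)

text \<open>Along the field of \<open>a\<close>, the quantity \<open>w\<close> changes at the rate
  \<open>snd (snd a) * w\<close> and \<open>\<xi>\<close> at the rate \<open>c a * w\<close>. One
  derivative of the potential \<open>r\<close> is \<open>- (r ^ 3) * M\<close>; the next is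
  therefore \<open>3 * r ^ 5 * M ^ 2\<close> minus \<open>r ^ 3\<close> times the derivative of
  \<open>M\<close>.\<close>

lemma sol_field_sol_field_sol_potential:
  fixes s b :: real
  assumes "s \<ge> 0"
  defines "\<xi> \<equiv> \<lambda>p. fst p - b * exp (snd (snd p))" and "w \<equiv> \<lambda>p. exp (snd (snd p))"
  defines "c \<equiv> \<lambda>a. fst a - b * snd (snd a)"
  shows "fderiv (\<lambda>p. fderiv (sol_potential s b) p (sol_field a p)) p (sol_field a p) =
    3 * (sol_potential s b p)^5 * (s * c a * \<xi> p * w p + snd (snd a) * (w p)\<^sup>2)\<^sup>2
    - (sol_potential s b p)^3 * (s * (c a)\<^sup>2 * (w p)\<^sup>2 + s * c a * snd (snd a) * \<xi> p * w p + 2 * (snd (snd a))\<^sup>2 * (w p)\<^sup>2)"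
proof -
  define M where "M p = s * c a * \<xi> p * w p + snd (snd a) * (w p)\<^sup>2" for p
  define r where "r = sol_potential s b"
  have r': "(r has_derivative fderiv r p) (at p)"
    unfolding r_def by (intro has_derivative_fderiv sol_potential_differentiable assms)
  have M': "(M has_derivative (\<lambda>v. s * c a * (fst v - b * w p * snd (snd v)) * w p
      + s * c a * \<xi> p * w p * snd (snd v) + 2 * snd (snd a) * (w p)\<^sup>2 * snd (snd v))) (at p)"
    unfolding M_def[abs_def] \<xi>_def w_def
    by (auto intro!: derivative_eq_intros simp: fun_eq_iff algebra_simps power2_eq_square)
  have r_field: "fderiv r p (sol_field a p) = - (r p ^ 3) * M p" for p
    unfolding r_def M_def \<xi>_def w_def c_def by (rule sol_field_sol_potential[OF assms(1)])
  have "((\<lambda>p. - (r p ^ 3) * M p) has_derivative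
      (\<lambda>v. - (3 * (r p)\<^sup>2 * fderiv r p v) * M p - (r p)^3 * (s * c a * (fst v - b * w p * snd (snd v)) * w p
      + s * c a * \<xi> p * w p * snd (snd v) + 2 * snd (snd a) * (w p)\<^sup>2 * snd (snd v)))) (at p)"
    by (auto intro!: derivative_eq_intros r' M' simp: fun_eq_iff algebra_simps power2_eq_square)
  then have "fderiv (\<lambda>p. fderiv r p (sol_field a p)) p (sol_field a p) = 3 * (r p)^5 * (M p)\<^sup>2
      - (r p)^3 * (s * c a * (c a * w p) * w p + s * c a * \<xi> p * w p * snd (snd a) + 2 * snd (snd a) * (w p)\<^sup>2 * snd (snd a))"
    unfolding r_field
    by (simp add: has_derivative_imp_fderiv r_field)
      (simp add: sol_field_def c_def w_def algebra_simps power2_eq_square power3_eq_cube numeral_eq_Suc)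
  then show ?thesis
    by (simp add: M_def r_def algebra_simps power2_eq_square)
qed

text \<open>The field of \<open>e1\<close> contributes nothing. The other two would cancel for the
  pure Newtonian potential; the summand 1 in the quadratic leaves
  \<open>- (3 * r ^ 5 * \<delta>\<^sub>3 ^ 2 * w ^ 2)\<close>.\<close>

lemma (in sol_basis) sol_potential_strictly_superharmonic:
  defines "s \<equiv> (\<delta>\<^sub>3 / \<alpha>\<^sub>2)\<^sup>2" and "b \<equiv> \<alpha>\<^sub>3 / \<delta>\<^sub>3"
  shows "(\<Sum>a\<in>{e1, e2, e3}. fderiv (\<lambda>p. fderiv (sol_potential s b) p (sol_field a p)) p (sol_field a p)) < 0"
proof -
  define w where "w = exp (snd (snd p))"
  define \<xi> where "\<xi> = fst p - b * w"
  define r where "r = sol_potential s b p"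
  have s: "s \<ge> 0" by (simp add: s_def)
  have r: "r > 0" "r\<^sup>2 * (1 + s * \<xi>\<^sup>2 + w\<^sup>2) = 1"
  proof -
    show "r > 0" unfolding r_def by (rule sol_potential_pos[OF s])
    have "r\<^sup>2 * sol_quadratic s b p = 1"
      using sol_quadratic_pos[OF s, of b p] by (simp add: r_def sol_potential_def power_inverse)
    then show "r\<^sup>2 * (1 + s * \<xi>\<^sup>2 + w\<^sup>2) = 1" by (simp add: sol_quadratic_def \<xi>_def w_def)
  qed
  have r5: "r^5 = r^3 * r\<^sup>2" by (simp flip: power_add)
  have w: "w > 0" by (simp add: w_def)
  \<comment> \<open>The choice of \<open>s\<close> gives the contributions of \<open>e2\<close> and
    \<open>e3\<close> the common factor \<open>\<delta>\<^sub>3 ^ 2\<close>; the choice of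
    \<open>b\<close> makes \<open>\<xi>\<close> constant along the field of
    \<open>e3\<close>.\<close>
  have sc: "s * \<alpha>\<^sub>2\<^sup>2 = \<delta>\<^sub>3\<^sup>2" "\<alpha>\<^sub>3 - b * \<delta>\<^sub>3 = 0"
    using nonzero by (simp_all add: s_def b_def power_divide)
  have "(\<Sum>a\<in>{e1, e2, e3}. fderiv (\<lambda>p. fderiv (sol_potential s b) p (sol_field a p)) p (sol_field a p))
     = 3 * r^5 * (s * \<alpha>\<^sub>2 * \<xi> * w)\<^sup>2 - r^3 * (s * \<alpha>\<^sub>2\<^sup>2 * w\<^sup>2) + (3 * r^5 * (\<delta>\<^sub>3 * w\<^sup>2)\<^sup>2 - r^3 * (2 * \<delta>\<^sub>3\<^sup>2 * w\<^sup>2))"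
    using distinct_basis sc
    by (simp add: sol_field_sol_field_sol_potential[OF s] e1_def e2_def e3_def flip: r_def w_def \<xi>_def)
  also have "\<dots> = 3 * r^5 * (s * (s * \<alpha>\<^sub>2\<^sup>2) * \<xi>\<^sup>2 * w\<^sup>2) - r^3 * (s * \<alpha>\<^sub>2\<^sup>2 * w\<^sup>2) + (3 * r^5 * (\<delta>\<^sub>3 * w\<^sup>2)\<^sup>2 - r^3 * (2 * \<delta>\<^sub>3\<^sup>2 * w\<^sup>2))"
    by (simp add: power2_eq_square algebra_simps)
  also have "\<dots> = 3 * r^5 * \<delta>\<^sub>3\<^sup>2 * w\<^sup>2 * (s * \<xi>\<^sup>2 + w\<^sup>2) - 3 * r^3 * \<delta>\<^sub>3\<^sup>2 * w\<^sup>2"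
    unfolding sc by (simp add: power2_eq_square algebra_simps)
  also have "\<dots> = 3 * r^3 * \<delta>\<^sub>3\<^sup>2 * w\<^sup>2 * (r\<^sup>2 * (s * \<xi>\<^sup>2 + w\<^sup>2)) - 3 * r^3 * \<delta>\<^sub>3\<^sup>2 * w\<^sup>2"
    by (simp only: r5 mult_ac)
  also have "r\<^sup>2 * (s * \<xi>\<^sup>2 + w\<^sup>2) = 1 - r\<^sup>2"
    using r(2) by (simp add: algebra_simps)
  also have "3 * r^3 * \<delta>\<^sub>3\<^sup>2 * w\<^sup>2 * (1 - r\<^sup>2) - 3 * r^3 * \<delta>\<^sub>3\<^sup>2 * w\<^sup>2 = - (3 * r^5 * \<delta>\<^sub>3\<^sup>2 * w\<^sup>2)"
    by (simp add: right_diff_distrib mult_ac)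
  also have "\<dots> < 0" using r(1) w nonzero by simp
  finally show ?thesis .
qed

text \<open>Gram-Schmidt applied to \<open>(0, 1, 0)\<close>, \<open>(1, 0, 0)\<close>,
  \<open>(0, 0, 1)\<close> in this order.\<close>

lemma sol_basis_exists:
  fixes m :: "real \<times> real \<times> real \<Rightarrow> real \<times> real \<times> real \<Rightarrow> real"
  assumes m: "bilinear m" "\<And>v w. m v w = m w v" "\<And>v. v \<noteq> 0 \<Longrightarrow> m v v > 0"
  shows "\<exists>\<alpha>\<^sub>2 \<alpha>\<^sub>3 \<beta>\<^sub>1 \<beta>\<^sub>2 \<beta>\<^sub>3 \<delta>\<^sub>3 e1 e2 e3. sol_basis m \<alpha>\<^sub>2 \<alpha>\<^sub>3 \<beta>\<^sub>1 \<beta>\<^sub>2 \<beta>\<^sub>3 \<delta>\<^sub>3 e1 e2 e3"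
proof -
  note ms = bilinear_lmul[OF m(1)] bilinear_rmul[OF m(1)] bilinear_lsub[OF m(1)] bilinear_rsub[OF m(1)]
  have unit: "\<exists>c. c \<noteq> 0 \<and> m (c *\<^sub>R v) (c *\<^sub>R v) = 1" if "v \<noteq> 0" for v
    using m(3)[OF that] by (intro exI[of _ "inverse (sqrt (m v v))"]) (simp add: ms field_simps)
  obtain \<beta>\<^sub>1 where e1: "\<beta>\<^sub>1 \<noteq> 0" "m (0, \<beta>\<^sub>1, 0) (0, \<beta>\<^sub>1, 0) = 1"
    using unit[of "(0, 1, 0)"] by (auto simp: zero_prod_def)
  define e1 where "e1 = (0::real, \<beta>\<^sub>1, 0::real)"
  define f2 where "f2 = (1, 0, 0) - m (1, 0, 0) e1 *\<^sub>R e1"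
  have f2: "f2 = (1, fst (snd f2), 0)" by (simp add: f2_def e1_def)
  have "f2 \<noteq> 0" by (subst f2) (simp add: zero_prod_def)
  obtain c2 where c2: "c2 \<noteq> 0" "m (c2 *\<^sub>R f2) (c2 *\<^sub>R f2) = 1" using unit[OF \<open>f2 \<noteq> 0\<close>] by auto
  define e2 where "e2 = c2 *\<^sub>R f2"
  have u1: "m e1 e1 = 1" "m e2 e2 = 1" using e1 c2 by (simp_all add: e1_def e2_def)
  have o12: "m e1 e2 = 0" by (simp add: e2_def f2_def ms u1 m(2)[of e1 "(1, 0, 0)"])
  define f3 where "f3 = (0, 0, 1) - m (0, 0, 1) e1 *\<^sub>R e1 - m (0, 0, 1) e2 *\<^sub>R e2"
  have e2: "e2 = (c2, c2 * fst (snd f2), 0)" unfolding e2_def by (subst f2) simp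
  have f3: "f3 = (fst f3, fst (snd f3), 1)" by (simp add: f3_def e1_def e2)
  have "f3 \<noteq> 0" by (subst f3) (simp add: zero_prod_def)
  obtain c3 where c3: "c3 \<noteq> 0" "m (c3 *\<^sub>R f3) (c3 *\<^sub>R f3) = 1" using unit[OF \<open>f3 \<noteq> 0\<close>] by auto
  have e3: "c3 *\<^sub>R f3 = (c3 * fst f3, c3 * fst (snd f3), c3)" by (subst f3) simp
  have o3: "m e1 (c3 *\<^sub>R f3) = 0" "m e2 (c3 *\<^sub>R f3) = 0"
    using o12 m(2)[of e2 e1] by (simp_all add: f3_def ms u1 m(2)[of e1 "(0, 0, 1)"] m(2)[of e2 "(0, 0, 1)"])
  have "sol_basis m c2 (c3 * fst f3) \<beta>\<^sub>1 (c2 * fst (snd f2)) (c3 * fst (snd f3)) c3 e1 e2 (c3 *\<^sub>R f3)"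
    by (rule sol_basis.intro) (fact m e1 c2 c3 e2 e3 u1 o12 o3 e1_def)+
  then show ?thesis by blast
qed


section \<open>Left-invariant metrics in a chart\<close>

text \<open>A single chart, freed from the manifold: \<open>\<phi>\<close> leads from chart
  coordinates to \<open>Sol3\<close> and \<open>\<psi>\<close> back. Left invariance of the metric
  appears as the constancy of the inner products of the left-invariant fields pushed forward by
  \<open>\<psi>\<close>.\<close>

locale sol_chart = sol_basis m \<alpha>\<^sub>2 \<alpha>\<^sub>3 \<beta>\<^sub>1 \<beta>\<^sub>2 \<beta>\<^sub>3 \<delta>\<^sub>3 e1 e2 e3
  for m \<alpha>\<^sub>2 \<alpha>\<^sub>3 \<beta>\<^sub>1 \<beta>\<^sub>2 \<beta>\<^sub>3 \<delta>\<^sub>3 e1 e2 e3 +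
  fixes U :: "'e::euclidean_space set" and V :: "(real \<times> real \<times> real) set" and \<phi> \<psi>
    and \<gamma> :: "'e \<Rightarrow> 'e \<Rightarrow> 'e \<Rightarrow> real"
  assumes open_U: "open U" and open_V: "open V"
    and C2_\<phi>: "C_k_on 2 U \<phi>" and C2_\<psi>: "C_k_on 2 V \<psi>"
    and \<phi>_in: "x \<in> U \<Longrightarrow> \<phi> x \<in> V" and \<psi>_in: "q \<in> V \<Longrightarrow> \<psi> q \<in> U"
    and \<psi>_\<phi>: "x \<in> U \<Longrightarrow> \<psi> (\<phi> x) = x" and \<phi>_\<psi>: "q \<in> V \<Longrightarrow> \<phi> (\<psi> q) = q"
    and bilinear_\<gamma>: "x \<in> U \<Longrightarrow> bilinear (\<gamma> x)"
    and \<gamma>_sym: "x \<in> U \<Longrightarrow> \<gamma> x v w = \<gamma> x w v"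
    and \<gamma>_differentiable: "x \<in> U \<Longrightarrow> (\<lambda>y. \<gamma> y v w) differentiable (at x)"
    and \<gamma>_left_invariant: "x \<in> U \<Longrightarrow>
      \<gamma> x (fderiv \<psi> (\<phi> x) (sol_field a (\<phi> x))) (fderiv \<psi> (\<phi> x) (sol_field b (\<phi> x))) = m a b"
begin

definition E :: "real \<times> real \<times> real \<Rightarrow> 'e \<Rightarrow> 'e" where
  "E a x = fderiv \<psi> (\<phi> x) (sol_field a (\<phi> x))"

section \<open>The left-invariant fields carried into the chart\<close>

lemma \<phi>_differentiable: "x \<in> U \<Longrightarrow> \<phi> differentiable (at x)"
  and fderiv_\<phi>_differentiable: "x \<in> U \<Longrightarrow> (\<lambda>y. fderiv \<phi> y v) differentiable (at x)"
  and \<psi>_differentiable: "q \<in> V \<Longrightarrow> \<psi> differentiable (at q)"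
  and fderiv_\<psi>_differentiable: "q \<in> V \<Longrightarrow> (\<lambda>q. fderiv \<psi> q w) differentiable (at q)"
  using C2_\<phi> C2_\<psi> unfolding C_k_on_2_iff by blast+

lemma linear_fderiv_\<phi>: "x \<in> U \<Longrightarrow> linear (fderiv \<phi> x)"
  by (intro linear_frechet_derivative \<phi>_differentiable)

lemma linear_fderiv_\<psi>: "x \<in> U \<Longrightarrow> linear (fderiv \<psi> (\<phi> x))"
  by (intro linear_frechet_derivative \<psi>_differentiable \<phi>_in)

lemma fderiv_\<psi>_\<phi>:
  assumes "x \<in> U" shows "fderiv \<psi> (\<phi> x) (fderiv \<phi> x v) = v"
  by (rule fderiv_left_inverse[OF open_U assms \<phi>_differentiable[OF assms] \<psi>_differentiable[OF \<phi>_in[OF assms]] \<psi>_\<phi>])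

lemma fderiv_\<phi>_\<psi>:
  assumes "x \<in> U" shows "fderiv \<phi> x (fderiv \<psi> (\<phi> x) v) = v"
  using fderiv_left_inverse[OF open_V \<phi>_in[OF assms] \<psi>_differentiable[OF \<phi>_in[OF assms]] _ \<phi>_\<psi>, of v]
    \<phi>_differentiable[OF assms] by (simp add: \<psi>_\<phi> assms)

lemma fderiv_\<phi>_E: "x \<in> U \<Longrightarrow> fderiv \<phi> x (E a x) = sol_field a (\<phi> x)"
  by (simp add: E_def fderiv_\<phi>_\<psi>)

lemma linear_E: "x \<in> U \<Longrightarrow> linear (\<lambda>a. E a x)"
  unfolding E_def using linear_compose[OF linear_sol_field linear_fderiv_\<psi>] by (simp add: o_def)

lemma E_onto: "x \<in> U \<Longrightarrow> \<exists>a. E a x = v"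
  using sol_field_onto[of "\<phi> x" "fderiv \<phi> x v"] by (metis E_def fderiv_\<psi>_\<phi>)

lemma has_derivative_\<phi>: "x \<in> U \<Longrightarrow> (\<phi> has_derivative fderiv \<phi> x) (at x)"
  by (intro has_derivative_fderiv \<phi>_differentiable)

lemma has_derivative_sol_field_\<phi>:
  assumes "x \<in> U"
  shows "((\<lambda>y. sol_field a (\<phi> y)) has_derivative (\<lambda>v. fderiv (sol_field a) (\<phi> x) (fderiv \<phi> x v))) (at x)"
  by (rule has_derivative_compose[OF has_derivative_\<phi>[OF assms]
        has_derivative_fderiv[OF differentiableI[OF has_derivative_sol_field]]])

lemma E_differentiable:
  assumes "x \<in> U" shows "E a differentiable (at x)"
proof -
  have L: "(\<lambda>y. fderiv \<psi> (\<phi> y) v) differentiable (at x)" for v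
    using differentiable_chain_at[OF \<phi>_differentiable[OF assms] fderiv_\<psi>_differentiable[OF \<phi>_in[OF assms]]]
    by (simp add: o_def)
  show ?thesis
    unfolding E_def[abs_def]
    by (rule differentiableI, rule has_derivative_linear_family_apply[where L = "\<lambda>y. fderiv \<psi> (\<phi> y)",
          OF open_U assms linear_fderiv_\<psi> L has_derivative_sol_field_\<phi>[OF assms]])
qed

text \<open>Differentiating \<open>D\<phi>(E\<^sub>a) = F\<^sub>a \<circ> \<phi>\<close> along \<open>E\<^sub>b\<close> and antisymmetrising, the second derivative of \<open>\<phi>\<close> cancels.\<close>

lemma E_bracket:
  assumes x: "x \<in> U"
  shows "fderiv (E a) x (E b x) - fderiv (E b) x (E a x) = E (sol_bracket a b) x"
proof -
  have D: "fderiv \<phi> x (fderiv (E a) x v) + fderiv (\<lambda>y. fderiv \<phi> y (E a x)) x v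
      = fderiv (sol_field a) (\<phi> x) (fderiv \<phi> x v)" for a v
  proof -
    have "((\<lambda>y. fderiv \<phi> y (E a y)) has_derivative
        (\<lambda>v. fderiv \<phi> x (fderiv (E a) x v) + fderiv (\<lambda>y. fderiv \<phi> y (E a x)) x v)) (at x)"
      by (rule has_derivative_linear_family_apply[OF open_U x linear_fderiv_\<phi> fderiv_\<phi>_differentiable[OF x]
            has_derivative_fderiv[OF E_differentiable[OF x]]])
    moreover have "((\<lambda>y. fderiv \<phi> y (E a y)) has_derivative
        (\<lambda>v. fderiv (sol_field a) (\<phi> x) (fderiv \<phi> x v))) (at x)"
      by (rule has_derivative_transform_within_open[OF has_derivative_sol_field_\<phi>[OF x] open_U x])
        (simp add: fderiv_\<phi>_E)
    ultimately show ?thesis by (rule fun_cong[OF has_derivative_unique])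
  qed
  have D': "fderiv \<phi> x (fderiv (E a) x (E b x))
      = fderiv (sol_field a) (\<phi> x) (sol_field b (\<phi> x)) - fderiv (\<lambda>y. fderiv \<phi> y (E a x)) x (E b x)" for a b
    using D[of a "E b x"] by (simp add: eq_diff_eq fderiv_\<phi>_E x)
  have "fderiv \<phi> x (fderiv (E a) x (E b x) - fderiv (E b) x (E a x))
      = fderiv (sol_field a) (\<phi> x) (sol_field b (\<phi> x)) - fderiv (sol_field b) (\<phi> x) (sol_field a (\<phi> x))"
    by (simp add: linear_diff[OF linear_fderiv_\<phi>[OF x]] D'
        second_fderiv_symmetric[OF C2_\<phi> open_U x, of "E a x" "E b x"])
  also have "\<dots> = fderiv \<phi> x (E (sol_bracket a b) x)"
    by (simp add: sol_field_bracket fderiv_\<phi>_E x)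
  finally show ?thesis by (metis fderiv_\<psi>_\<phi> x)
qed

lemma \<gamma>_E: "x \<in> U \<Longrightarrow> \<gamma> x (E a x) (E b x) = m a b"
  unfolding E_def by (rule \<gamma>_left_invariant)

sublocale orthonormal_frame U \<gamma> "{e1, e2, e3}" E
proof
  fix x and v :: 'e assume x: "x \<in> U"
  obtain a where a: "v = E a x" using E_onto[OF x] by metis
  have "(\<Sum>i\<in>{e1, e2, e3}. \<gamma> x v (E i x) *\<^sub>R E i x) = E (\<Sum>i\<in>{e1, e2, e3}. m a i *\<^sub>R i) x"
    unfolding linear_sum[OF linear_E[OF x]] linear_cmul[OF linear_E[OF x]] a \<gamma>_E[OF x] ..
  then show "(\<Sum>i\<in>{e1, e2, e3}. \<gamma> x v (E i x) *\<^sub>R E i x) = v"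
    by (simp only: basis_expansion a)
qed (use open_U bilinear_\<gamma> \<gamma>_sym \<gamma>_differentiable E_differentiable \<gamma>_E basis_orthonormal in auto)

text \<open>Left invariance and \<open>E_bracket\<close> turn the frame formula for the divergence
  into the trace of an adjoint map, which vanishes by unimodularity.\<close>

lemma divergence_E:
  assumes "x \<in> U" "i \<in> {e1, e2, e3}"
  shows "divergence \<gamma> (E i) x = 0"
  unfolding divergence_frame_field[OF assms] E_bracket[OF assms(1)] \<gamma>_E[OF assms(1)]
  by (rule trace_ad[OF assms(2)])

lemma laplacian_invariant:
  assumes W: "open W" "W \<subseteq> U" "x \<in> W"
    and u: "\<And>y. y \<in> W \<Longrightarrow> u differentiable (at y)" "\<And>v. (\<lambda>y. fderiv u y v) differentiable (at x)"
  shows "laplacian \<gamma> u x = (\<Sum>a\<in>{e1, e2, e3}. fderiv (\<lambda>y. fderiv u y (E a y)) x (E a x))"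
proof -
  have x: "x \<in> U" using W by auto
  have "laplacian \<gamma> u x = (\<Sum>a\<in>{e1, e2, e3}. fderiv (\<lambda>y. fderiv u y (E a y)) x (E a x)
      + fderiv u x (E a x) * divergence \<gamma> (E a) x)"
    by (rule laplacian_frame[OF W u])
  also have "\<dots> = (\<Sum>a\<in>{e1, e2, e3}. fderiv (\<lambda>y. fderiv u y (E a y)) x (E a x))"
    by (intro sum.cong[OF refl]) (simp only: divergence_E[OF x] mult_zero_right add_0_right)
  finally show ?thesis .
qed

section \<open>The potential in chart coordinates and the maximum principle\<close>

abbreviation potential :: "real \<times> real \<times> real \<Rightarrow> real" where
  "potential \<equiv> sol_potential ((\<delta>\<^sub>3 / \<alpha>\<^sub>2)\<^sup>2) (\<alpha>\<^sub>3 / \<delta>\<^sub>3)"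

lemma has_derivative_potential_\<phi>:
  assumes "x \<in> U"
  shows "((\<lambda>y. potential (\<phi> y)) has_derivative (\<lambda>v. fderiv potential (\<phi> x) (fderiv \<phi> x v))) (at x)"
  by (rule has_derivative_compose[OF has_derivative_\<phi>[OF assms]])
    (simp add: has_derivative_fderiv sol_potential_differentiable)

lemma fderiv_potential_\<phi>:
  "x \<in> U \<Longrightarrow> fderiv (\<lambda>y. potential (\<phi> y)) x = (\<lambda>v. fderiv potential (\<phi> x) (fderiv \<phi> x v))"
  by (rule has_derivative_imp_fderiv[OF has_derivative_potential_\<phi>])

lemma fderiv_potential_\<phi>_differentiable:
  assumes x: "x \<in> U"
  shows "(\<lambda>y. fderiv (\<lambda>y. potential (\<phi> y)) y v) differentiable (at x)"
proof -
  have L: "(\<lambda>y. fderiv potential (\<phi> y) v) differentiable (at x)" for v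
    using differentiable_chain_at[OF \<phi>_differentiable[OF x] fderiv_sol_potential_differentiable]
    by (simp add: o_def)
  have "((\<lambda>y. fderiv potential (\<phi> y) (fderiv \<phi> y v)) has_derivative
      (\<lambda>w. fderiv potential (\<phi> x) (fderiv (\<lambda>y. fderiv \<phi> y v) x w)
        + fderiv (\<lambda>y. fderiv potential (\<phi> y) (fderiv \<phi> x v)) x w)) (at x)"
    by (rule has_derivative_linear_family_apply[where L = "\<lambda>y. fderiv potential (\<phi> y)", OF open_U x _ L
          has_derivative_fderiv[OF fderiv_\<phi>_differentiable[OF x]]])
      (simp add: linear_frechet_derivative sol_potential_differentiable)
  then have "((\<lambda>y. fderiv (\<lambda>y. potential (\<phi> y)) y v) has_derivative
      (\<lambda>w. fderiv potential (\<phi> x) (fderiv (\<lambda>y. fderiv \<phi> y v) x w)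
        + fderiv (\<lambda>y. fderiv potential (\<phi> y) (fderiv \<phi> x v)) x w)) (at x)"
    by (rule has_derivative_transform_within_open[OF _ open_U x]) (simp add: fderiv_potential_\<phi>)
  then show ?thesis by (auto simp: differentiable_def)
qed

text \<open>The fields \<open>E a\<close> and \<open>sol_field a\<close> are related by
  \<open>\<phi>\<close>, so differentiating a pulled-back function along \<open>E a\<close> is
  pulling back a derivative. This moves the Laplacian of the potential to
  \<open>Sol3\<close>.\<close>

lemma E_E_potential:
  assumes x: "x \<in> U"
  shows "fderiv (\<lambda>y. fderiv (\<lambda>y. potential (\<phi> y)) y (E a y)) x (E a x)
    = fderiv (\<lambda>p. fderiv potential p (sol_field a p)) (\<phi> x) (sol_field a (\<phi> x))"
proof -
  have "(\<lambda>p. fderiv potential p (sol_field a p)) differentiable (at (\<phi> x))"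
    by (rule differentiableI, rule has_derivative_linear_family_apply[where L = "fderiv potential",
          OF open_UNIV UNIV_I _ fderiv_sol_potential_differentiable has_derivative_sol_field])
      (simp_all add: linear_frechet_derivative sol_potential_differentiable)
  from has_derivative_compose[OF has_derivative_\<phi>[OF x] has_derivative_fderiv[OF this]]
  have "((\<lambda>y. fderiv (\<lambda>y. potential (\<phi> y)) y (E a y)) has_derivative
      (\<lambda>v. fderiv (\<lambda>p. fderiv potential p (sol_field a p)) (\<phi> x) (fderiv \<phi> x v))) (at x)"
    by (rule has_derivative_transform_within_open[OF _ open_U x])
      (simp add: fderiv_potential_\<phi> fderiv_\<phi>_E)
  then show ?thesis by (simp add: has_derivative_imp_fderiv fderiv_\<phi>_E x)
qed

text \<open>At a maximum of \<open>h\<close> minus the potential, each second derivative along a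
  frame field is at most 0. Summed over the frame, this bounds the Laplacian of \<open>h\<close> by
  that of the potential, which is negative, while \<open>h\<close> has Laplacian 0 at
  \<open>x\<close>.\<close>

lemma no_interior_maximum:
  assumes W: "open W" "W \<subseteq> U" "x \<in> W"
    and h: "C_k_on 2 W h" "laplacian \<gamma> h x = 0"
    and max: "\<And>y. y \<in> W \<Longrightarrow> h y - potential (\<phi> y) \<le> h x - potential (\<phi> x)"
  shows False
proof -
  define u where "u = (\<lambda>y. potential (\<phi> y))"
  have x: "x \<in> U" using W by auto
  have h1: "h differentiable (at y)" "(\<lambda>y. fderiv h y v) differentiable (at y)" if "y \<in> W" for y v
    using h(1) that by (auto simp: C_k_on_2_iff)
  have u1: "u differentiable (at y)" if "y \<in> W" for y
    using has_derivative_potential_\<phi>[of y] that W by (auto simp: differentiable_def u_def)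
  have u2: "(\<lambda>y. fderiv u y v) differentiable (at x)" for v
    unfolding u_def by (rule fderiv_potential_\<phi>_differentiable[OF x])
  define k where "k = (\<lambda>y. h y - u y)"
  have k: "(k has_derivative (\<lambda>v. fderiv h y v - fderiv u y v)) (at y)" if "y \<in> W" for y
    unfolding k_def by (intro has_derivative_diff has_derivative_fderiv h1 u1 that)
  have k1: "k differentiable (at y)" if "y \<in> W" for y
    using k[OF that] by (auto simp: differentiable_def)
  have fderiv_k: "fderiv k y = (\<lambda>v. fderiv h y v - fderiv u y v)" if "y \<in> W" for y
    by (rule has_derivative_imp_fderiv[OF k[OF that]])
  have k2: "(\<lambda>y. fderiv k y v) differentiable (at x)" for v
  proof -
    have "((\<lambda>y. fderiv h y v - fderiv u y v) has_derivative
        (\<lambda>w. fderiv (\<lambda>y. fderiv h y v) x w - fderiv (\<lambda>y. fderiv u y v) x w)) (at x)"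
      by (intro has_derivative_diff has_derivative_fderiv h1 u2 W)
    then have "((\<lambda>y. fderiv k y v) has_derivative
        (\<lambda>w. fderiv (\<lambda>y. fderiv h y v) x w - fderiv (\<lambda>y. fderiv u y v) x w)) (at x)"
      by (rule has_derivative_transform_within_open[OF _ W(1,3)]) (simp add: fderiv_k)
    then show ?thesis by (auto simp: differentiable_def)
  qed
  have crit: "fderiv k x = (\<lambda>v. 0)"
    using differential_zero_maxmin[OF W(3,1) has_derivative_fderiv[OF k1[OF W(3)]]] max
    by (auto simp: k_def u_def)
  \<comment> \<open>The first summand sees how the field varies and involves only the first
    derivative of \<open>f\<close>; the second is the Hessian in a frozen direction.\<close>
  have EE: "((\<lambda>y. fderiv f y (E a y)) has_derivative
      (\<lambda>v. fderiv f x (fderiv (E a) x v) + fderiv (\<lambda>y. fderiv f y (E a x)) x v)) (at x)"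
    if "\<And>y. y \<in> W \<Longrightarrow> f differentiable (at y)" "\<And>v. (\<lambda>y. fderiv f y v) differentiable (at x)"
    for f :: "'e \<Rightarrow> real" and a
    by (rule has_derivative_linear_family_apply[where L = "fderiv f", OF W(1,3) linear_frechet_derivative[OF that(1)] that(2)
          has_derivative_fderiv[OF E_differentiable[OF x]]])
  have "fderiv (\<lambda>y. fderiv h y (E a y)) x (E a x) \<le> fderiv (\<lambda>y. fderiv u y (E a y)) x (E a x)" for a
  proof -
    have "((\<lambda>y. fderiv h y (E a y) - fderiv u y (E a y)) has_derivative
        (\<lambda>v. fderiv (\<lambda>y. fderiv h y (E a y)) x v - fderiv (\<lambda>y. fderiv u y (E a y)) x v)) (at x)"
      by (intro has_derivative_diff has_derivative_fderiv differentiableI[OF EE[OF h1(1) h1(2)[OF W(3)]]]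
          differentiableI[OF EE[OF u1 u2]])
    then have "((\<lambda>y. fderiv k y (E a y)) has_derivative
        (\<lambda>v. fderiv (\<lambda>y. fderiv h y (E a y)) x v - fderiv (\<lambda>y. fderiv u y (E a y)) x v)) (at x)"
      by (rule has_derivative_transform_within_open[OF _ W(1,3)]) (simp add: fderiv_k)
    then have "fderiv (\<lambda>y. fderiv h y (E a y)) x (E a x) - fderiv (\<lambda>y. fderiv u y (E a y)) x (E a x)
        = fderiv (\<lambda>y. fderiv k y (E a y)) x (E a x)"
      by (simp add: has_derivative_imp_fderiv)
    \<comment> \<open>At the critical point the first-order summand of \<open>EE\<close> vanishes,
      so the field may be frozen at \<open>x\<close>.\<close>
    also have "\<dots> = fderiv (\<lambda>y. fderiv k y (E a x)) x (E a x)"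
      by (simp add: has_derivative_imp_fderiv[OF EE[OF k1 k2]] crit)
    also have "\<dots> \<le> 0"
      by (rule second_fderiv_nonpos_at_max[OF W(1,3) k1 k2]) (use max in \<open>auto simp: k_def u_def\<close>)
    finally show ?thesis by simp
  qed
  then have "(\<Sum>a\<in>{e1, e2, e3}. fderiv (\<lambda>y. fderiv h y (E a y)) x (E a x))
      \<le> (\<Sum>a\<in>{e1, e2, e3}. fderiv (\<lambda>y. fderiv u y (E a y)) x (E a x))"
    by (rule sum_mono)
  also have "\<dots> < 0"
    unfolding u_def E_E_potential[OF x] by (rule sol_potential_strictly_superharmonic)
  finally show False
    using laplacian_invariant[OF W h1(1) h1(2)[OF W(3)]] h(2) by simp
qed

end


section \<open>Metric Lie groups isomorphic to \<open>Sol\<^sub>3\<close>\<close>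

lemma has_derivative_sol_translation:
  "((\<lambda>q. p \<otimes>\<^bsub>Sol3\<^esub> q) has_derivative
     (\<lambda>v. (exp (snd (snd p)) * fst v, exp (- snd (snd p)) * fst (snd v), snd (snd v)))) (at q)"
  unfolding Sol3_def
  by (auto intro!: derivative_eq_intros simp: case_prod_unfold fun_eq_iff)

lemma fderiv_sol_translation_sol_field:
  "fderiv (\<lambda>q. p \<otimes>\<^bsub>Sol3\<^esub> q) q (sol_field a q) = sol_field a (p \<otimes>\<^bsub>Sol3\<^esub> q)"
  by (simp add: has_derivative_imp_fderiv[OF has_derivative_sol_translation])
    (simp add: sol_field_def Sol3_def case_prod_unfold exp_add exp_diff exp_minus divide_inverse)

lemma one_Sol3: "\<one>\<^bsub>Sol3\<^esub> = 0"
  by (simp add: Sol3_def zero_prod_def)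

lemma carrier_Sol3: "carrier Sol3 = UNIV"
  by (simp add: Sol3_def)

locale metric_sol_group =
  fixes G :: "'a monoid" and T :: "'a topology"
    and A :: "('a, 'e::euclidean_space) chart set" and g :: "('a, 'e) metric"
    and \<Phi> :: "'a \<Rightarrow> real \<times> real \<times> real"
  assumes metric_lie: "metric_lie_group G T A g"
    and iso: "\<Phi> \<in> iso G Sol3"
    and smooth_\<Phi>: "smooth_map T A euclidean euclidean_atlas \<Phi>"
    and smooth_\<Psi>: "smooth_map euclidean euclidean_atlas T A (inv_into (carrier G) \<Phi>)"
begin

section \<open>The isomorphism expressed in charts\<close>

definition \<Psi> :: "real \<times> real \<times> real \<Rightarrow> 'a" where "\<Psi> = inv_into (carrier G) \<Phi>"

definition \<phi> :: "('a, 'e) chart \<Rightarrow> 'e \<Rightarrow> real \<times> real \<times> real" where "\<phi> c x = \<Phi> (chart_inv c x)"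

definition \<psi> :: "('a, 'e) chart \<Rightarrow> real \<times> real \<times> real \<Rightarrow> 'e" where "\<psi> c q = snd c (\<Psi> q)"

abbreviation (input) U :: "('a, 'e) chart \<Rightarrow> 'e set" where "U c \<equiv> snd c ` fst c"

abbreviation (input) V :: "('a, 'e) chart \<Rightarrow> (real \<times> real \<times> real) set" where "V c \<equiv> {q. \<Psi> q \<in> fst c}"

lemma lie: "group G" "carrier G = topspace T" "smooth_manifold T A" "riemannian_metric A g"
  and left_invariant: "a \<in> carrier G \<Longrightarrow> preserves_metric A g (\<lambda>p. a \<otimes>\<^bsub>G\<^esub> p)"
  using metric_lie by (auto simp: metric_lie_group_def lie_group_def)

lemma \<Psi>_in: "\<Psi> q \<in> topspace T"
  and \<Phi>_\<Psi>: "\<Phi> (\<Psi> q) = q"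
  and \<Psi>_\<Phi>: "p \<in> topspace T \<Longrightarrow> \<Psi> (\<Phi> p) = p"
proof -
  have bij: "bij_betw \<Phi> (topspace T) UNIV"
    using iso lie(2) by (simp add: iso_def carrier_Sol3)
  show "\<Psi> q \<in> topspace T"
    using bij_betw_apply[OF bij_betw_inv_into[OF bij], of q] by (simp add: \<Psi>_def lie)
  show "\<Phi> (\<Psi> q) = q"
    using bij_betw_inv_into_right[OF bij, of q] by (simp add: \<Psi>_def lie)
  show "\<Psi> (\<Phi> p) = p" if "p \<in> topspace T"
    using bij_betw_inv_into_left[OF bij that] by (simp add: \<Psi>_def lie)
qed

lemma \<Phi>_mult: "p \<in> topspace T \<Longrightarrow> q \<in> topspace T \<Longrightarrow> \<Phi> (p \<otimes>\<^bsub>G\<^esub> q) = \<Phi> p \<otimes>\<^bsub>Sol3\<^esub> \<Phi> q"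
  using iso lie(2) by (simp add: iso_def hom_def)

lemma \<Phi>_one: "\<Phi> \<one>\<^bsub>G\<^esub> = 0"
  using hom_one[OF _ lie(1) group_Sol3, of \<Phi>] iso by (simp add: iso_def one_Sol3)

lemma continuous_\<Phi>: "continuous_map T euclidean \<Phi>"
  and continuous_\<Psi>: "continuous_map euclidean T \<Psi>"
  using smooth_\<Phi> smooth_\<Psi> by (auto simp: smooth_map_def \<Psi>_def)

lemma chart:
  assumes "c \<in> A"
  shows "openin T (fst c)" "open (U c)"
    "homeomorphic_map (subtopology T (fst c)) (top_of_set (U c)) (snd c)"
  using lie(3) assms by (auto simp: smooth_manifold_def is_chart_def)

lemma chart_at: "p \<in> topspace T \<Longrightarrow> \<exists>c. c \<in> A \<and> p \<in> fst c"
  using lie(3) unfolding smooth_manifold_def by blast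

lemma chart_subset: "c \<in> A \<Longrightarrow> p \<in> fst c \<Longrightarrow> p \<in> topspace T"
  using openin_subset[OF chart(1)] by (rule subsetD)

lemma chart_inj:
  assumes "c \<in> A" shows "inj_on (snd c) (fst c)"
  using homeomorphic_imp_injective_map[OF chart(3)[OF assms]] chart_subset[OF assms]
  by (simp add: topspace_subtopology Int_absorb1 subsetI)

lemma chart_inv:
  assumes "c \<in> A"
  shows "p \<in> fst c \<Longrightarrow> chart_inv c (snd c p) = p"
    "x \<in> U c \<Longrightarrow> chart_inv c x \<in> fst c" "x \<in> U c \<Longrightarrow> snd c (chart_inv c x) = x"
  using chart_inj[OF assms] by (auto simp: chart_inv_def)

lemma open_V: "c \<in> A \<Longrightarrow> open (V c)"
  using openin_continuous_map_preimage[OF continuous_\<Psi> chart(1)] by simp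

lemma C2_\<phi>: "c \<in> A \<Longrightarrow> C_k_on 2 (U c) (\<phi> c)"
  using smooth_\<Phi>
  by (auto simp: smooth_map_def euclidean_atlas_def local_smooth_def local_rep_def \<phi>_def[abs_def]
      dest!: bspec smooth_on_imp_C2)

lemma chart_inv_euclidean: "chart_inv (UNIV, \<lambda>x. x) = (\<lambda>x. x)"
  by (simp add: chart_inv_def fun_eq_iff inv_into_f_f)

lemma C2_\<psi>: "c \<in> A \<Longrightarrow> C_k_on 2 (V c) (\<psi> c)"
  using smooth_\<Psi>
  by (auto simp: smooth_map_def euclidean_atlas_def local_smooth_def local_rep_def \<psi>_def[abs_def]
      chart_inv_euclidean \<Psi>_def[symmetric] dest!: bspec smooth_on_imp_C2)

lemma \<psi>_\<phi>: "c \<in> A \<Longrightarrow> x \<in> U c \<Longrightarrow> \<psi> c (\<phi> c x) = x"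
  and \<phi>_in: "c \<in> A \<Longrightarrow> x \<in> U c \<Longrightarrow> \<phi> c x \<in> V c"
  and \<phi>_\<psi>: "c \<in> A \<Longrightarrow> q \<in> V c \<Longrightarrow> \<phi> c (\<psi> c q) = q"
  and \<psi>_in: "q \<in> V c \<Longrightarrow> \<psi> c q \<in> U c"
  using chart_inv[of c] chart_subset[of c] by (auto simp: \<psi>_def \<phi>_def \<Psi>_\<Phi> \<Phi>_\<Psi>)

text \<open>Any chart around the identity will do; one is fixed so that the inner product at the
  identity can be written in coordinates.\<close>

definition base_chart :: "('a, 'e) chart" where
  "base_chart = (SOME d. d \<in> A \<and> \<one>\<^bsub>G\<^esub> \<in> fst d)"

lemma base_chart: "base_chart \<in> A" "\<one>\<^bsub>G\<^esub> \<in> fst base_chart"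
proof -
  have "\<one>\<^bsub>G\<^esub> \<in> topspace T"
    using monoid.one_closed[OF group.is_monoid[OF lie(1)]] lie(2) by simp
  then have "\<exists>d. d \<in> A \<and> \<one>\<^bsub>G\<^esub> \<in> fst d" by (rule chart_at)
  from someI_ex[OF this] show "base_chart \<in> A" "\<one>\<^bsub>G\<^esub> \<in> fst base_chart"
    by (auto simp: base_chart_def)
qed

text \<open>The inner product on the tangent space at the identity, pulled back along the
  differential of \<open>\<Psi>\<close> at 0. By left invariance it determines the metric
  everywhere.\<close>

definition m :: "real \<times> real \<times> real \<Rightarrow> real \<times> real \<times> real \<Rightarrow> real" where
  "m v w = g base_chart (snd base_chart \<one>\<^bsub>G\<^esub>) (fderiv (\<psi> base_chart) 0 v) (fderiv (\<psi> base_chart) 0 w)"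

lemma riemannian:
  assumes "c \<in> A" "x \<in> U c"
  shows "bilinear (g c x)" "g c x v w = g c x w v" "v \<noteq> 0 \<Longrightarrow> 0 < g c x v v"
    "(\<lambda>y. g c y v w) differentiable (at x)"
proof -
  have "(\<forall>x\<in>U c. bilinear (g c x) \<and> (\<forall>v w. g c x v w = g c x w v) \<and> (\<forall>v. v \<noteq> 0 \<longrightarrow> 0 < g c x v v)) \<and>
      (\<forall>v w. smooth_on (U c) (\<lambda>x. g c x v w))"
    using lie(4) assms(1) unfolding riemannian_metric_def by blast
  then have "bilinear (g c x) \<and> (\<forall>v w. g c x v w = g c x w v) \<and> (\<forall>v. v \<noteq> 0 \<longrightarrow> 0 < g c x v v)"
    and "C_k_on 2 (U c) (\<lambda>x. g c x v w)"
    using assms(2) smooth_on_imp_C2 by blast+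
  then show "bilinear (g c x)" "g c x v w = g c x w v" "v \<noteq> 0 \<Longrightarrow> 0 < g c x v v"
    "(\<lambda>y. g c y v w) differentiable (at x)"
    using assms(2) unfolding C_k_on_2_iff by blast+
qed

lemma zero_in_V: "0 \<in> V base_chart"
  using \<Psi>_\<Phi>[OF chart_subset[OF base_chart]] base_chart(2) by (simp add: \<Phi>_one)

lemma \<psi>_differentiable: "c \<in> A \<Longrightarrow> q \<in> V c \<Longrightarrow> \<psi> c differentiable (at q)"
  using C2_\<psi>[of c] unfolding C_k_on_2_iff by blast

lemma \<phi>_differentiable: "c \<in> A \<Longrightarrow> x \<in> U c \<Longrightarrow> \<phi> c differentiable (at x)"
  using C2_\<phi>[of c] unfolding C_k_on_2_iff by blast

lemma m_inner: "bilinear m" "m v w = m w v" "v \<noteq> 0 \<Longrightarrow> m v v > 0"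
proof -
  let ?d = base_chart and ?D = "fderiv (\<psi> base_chart) 0"
  have x: "snd ?d \<one>\<^bsub>G\<^esub> \<in> U ?d" using base_chart by auto
  note r = riemannian[OF base_chart(1) x]
  have lin: "linear ?D"
    by (intro linear_frechet_derivative \<psi>_differentiable base_chart zero_in_V)
  show "bilinear m"
    using linear_compose[OF lin, of "g ?d (snd ?d \<one>\<^bsub>G\<^esub>) a" for a]
      linear_compose[OF lin, of "\<lambda>v. g ?d (snd ?d \<one>\<^bsub>G\<^esub>) v b" for b] r(1)
    unfolding bilinear_def m_def[abs_def] by (simp add: o_def)
  show "m v w = m w v" unfolding m_def by (rule r(2))
  \<comment> \<open>Since \<open>\<phi> ?d\<close> undoes \<open>\<psi> ?d\<close>, the differential
    \<open>?D\<close> is injective, and \<open>m\<close> inherits positive definiteness.\<close>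
  have "fderiv (\<phi> ?d) (\<psi> ?d 0) (?D v) = v"
    by (rule fderiv_left_inverse[OF open_V[OF base_chart(1)] zero_in_V])
      (use base_chart(1) zero_in_V \<psi>_in \<phi>_\<psi> \<phi>_differentiable \<psi>_differentiable in blast)+
  moreover have "linear (fderiv (\<phi> ?d) (\<psi> ?d 0))"
    by (intro linear_frechet_derivative \<phi>_differentiable base_chart \<psi>_in zero_in_V)
  ultimately have "?D v \<noteq> 0" if "v \<noteq> 0" using that linear_0 by metis
  then show "v \<noteq> 0 \<Longrightarrow> m v v > 0" unfolding m_def by (intro r(3)) auto
qed

text \<open>Translation by the inverse of \<open>p\<close> is an isometry taking \<open>p\<close> to
  the identity. Read in \<open>Sol3\<close> it is again a left translation, so it carries the
  left-invariant field of \<open>a\<close> at \<open>\<phi> c x\<close> to its value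
  \<open>a\<close> at the identity.\<close>

lemma metric_left_invariant:
  assumes c: "c \<in> A" and x: "x \<in> U c"
  shows "g c x (fderiv (\<psi> c) (\<phi> c x) (sol_field a (\<phi> c x))) (fderiv (\<psi> c) (\<phi> c x) (sol_field b (\<phi> c x))) = m a b"
proof -
  let ?d = base_chart
  define p where "p = chart_inv c x"
  have p: "p \<in> fst c" "snd c p = x" "p \<in> topspace T"
    using chart_inv(2,3)[OF c x] chart_subset[OF c] by (simp_all add: p_def)
  define k where "k = inv\<^bsub>G\<^esub> p"
  have k: "k \<in> carrier G" "k \<otimes>\<^bsub>G\<^esub> p = \<one>\<^bsub>G\<^esub>"
    using group.inv_closed[OF lie(1), of p] group.l_inv[OF lie(1), of p] p(3) by (simp_all add: k_def lie(2))
  have k0: "\<Phi> k \<otimes>\<^bsub>Sol3\<^esub> \<phi> c x = 0"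
    using \<Phi>_mult[of k p] k lie(2) p(3) by (simp add: \<Phi>_one \<phi>_def p_def)
  \<comment> \<open>The translation in chart coordinates; it factors through \<open>Sol3\<close> as
    \<open>\<phi> c\<close>, a left translation and \<open>\<psi> ?d\<close>, which gives its
    differential by the chain rule.\<close>
  define \<tau> where "\<tau> = local_rep c ?d (\<lambda>q. k \<otimes>\<^bsub>G\<^esub> q)"
  have \<tau>: "\<psi> ?d (\<Phi> k \<otimes>\<^bsub>Sol3\<^esub> \<phi> c y) = \<tau> y" if "y \<in> U c" for y
  proof -
    have y: "chart_inv c y \<in> topspace T" by (rule chart_subset[OF c chart_inv(2)[OF c that]])
    then have "k \<otimes>\<^bsub>G\<^esub> chart_inv c y \<in> topspace T"
      using monoid.m_closed[OF group.is_monoid[OF lie(1)] k(1)] lie(2) by simp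
    then show ?thesis
      using \<Phi>_mult[of k "chart_inv c y"] k(1) lie(2) y \<Psi>_\<Phi>[of "k \<otimes>\<^bsub>G\<^esub> chart_inv c y"]
      by (simp add: \<tau>_def local_rep_def \<psi>_def \<phi>_def)
  qed
  have "((\<lambda>y. \<psi> ?d (\<Phi> k \<otimes>\<^bsub>Sol3\<^esub> \<phi> c y)) has_derivative
      (\<lambda>v. fderiv (\<psi> ?d) (\<Phi> k \<otimes>\<^bsub>Sol3\<^esub> \<phi> c x) (fderiv (\<lambda>q. \<Phi> k \<otimes>\<^bsub>Sol3\<^esub> q) (\<phi> c x) (fderiv (\<phi> c) x v)))) (at x)"
    by (rule has_derivative_compose[OF has_derivative_compose[OF
          has_derivative_fderiv[OF \<phi>_differentiable[OF c x]]
          has_derivative_fderiv[OF differentiableI[OF has_derivative_sol_translation]]]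
          has_derivative_fderiv])
      (use \<psi>_differentiable[OF base_chart(1)] zero_in_V in \<open>simp add: k0\<close>)
  then have "(\<tau> has_derivative
      (\<lambda>v. fderiv (\<psi> ?d) 0 (fderiv (\<lambda>q. \<Phi> k \<otimes>\<^bsub>Sol3\<^esub> q) (\<phi> c x) (fderiv (\<phi> c) x v)))) (at x)"
    unfolding k0 by (rule has_derivative_transform_within_open[OF _ chart(2)[OF c] x]) (rule \<tau>)
  then have D\<tau>: "fderiv \<tau> x v = fderiv (\<psi> ?d) 0 (fderiv (\<lambda>q. \<Phi> k \<otimes>\<^bsub>Sol3\<^esub> q) (\<phi> c x) (fderiv (\<phi> c) x v))" for v
    by (simp add: has_derivative_imp_fderiv)
  have inv: "fderiv (\<phi> c) x (fderiv (\<psi> c) (\<phi> c x) v) = v" for v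
  proof -
    have "fderiv (\<phi> c) (\<psi> c (\<phi> c x)) (fderiv (\<psi> c) (\<phi> c x) v) = v"
      by (rule fderiv_left_inverse[OF open_V[OF c] \<phi>_in[OF c x] \<psi>_differentiable[OF c \<phi>_in[OF c x]]])
        (use \<phi>_differentiable[OF c x] \<psi>_\<phi>[OF c x] \<phi>_\<psi>[OF c] in auto)
    then show ?thesis by (simp add: \<psi>_\<phi> c x)
  qed
  have "fderiv \<tau> x (fderiv (\<psi> c) (\<phi> c x) (sol_field a (\<phi> c x))) = fderiv (\<psi> ?d) 0 a" for a
    by (simp add: D\<tau> inv fderiv_sol_translation_sol_field k0)
  moreover have "g c x v w = g ?d (snd ?d \<one>\<^bsub>G\<^esub>) (fderiv \<tau> x v) (fderiv \<tau> x w)" for v w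
    using left_invariant[OF k(1)] c base_chart p k(2)
    unfolding preserves_metric_def \<tau>_def by metis
  ultimately show ?thesis by (simp add: m_def)
qed

lemma chart_locale:
  assumes "sol_basis m \<alpha>\<^sub>2 \<alpha>\<^sub>3 \<beta>\<^sub>1 \<beta>\<^sub>2 \<beta>\<^sub>3 \<delta>\<^sub>3 e1 e2 e3" "c \<in> A"
  shows "sol_chart m \<alpha>\<^sub>2 \<alpha>\<^sub>3 \<beta>\<^sub>1 \<beta>\<^sub>2 \<beta>\<^sub>3 \<delta>\<^sub>3 e1 e2 e3 (U c) (V c) (\<phi> c) (\<psi> c) (g c)"
proof (rule sol_chart.intro[OF assms(1)])
  note c = assms(2)
  show "sol_chart_axioms m (U c) (V c) (\<phi> c) (\<psi> c) (g c)"
    by (rule sol_chart_axioms.intro)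
      (fact chart(2)[OF c] open_V[OF c] C2_\<phi>[OF c] C2_\<psi>[OF c] \<phi>_in[OF c] \<psi>_in \<psi>_\<phi>[OF c] \<phi>_\<psi>[OF c]
        riemannian[OF c] metric_left_invariant[OF c])+
qed

text \<open>Semicontinuity follows from continuity. For the comparison, \<open>h - u\<close> attains
  its maximum on the compact closure; a positive maximum would have to lie inside the domain, where
  \<open>no_interior_maximum\<close> forbids it.\<close>

lemma superharmonic_potential:
  assumes basis: "sol_basis m \<alpha>\<^sub>2 \<alpha>\<^sub>3 \<beta>\<^sub>1 \<beta>\<^sub>2 \<beta>\<^sub>3 \<delta>\<^sub>3 e1 e2 e3"
  shows "superharmonic T A g (\<lambda>p. sol_potential ((\<delta>\<^sub>3 / \<alpha>\<^sub>2)\<^sup>2) (\<alpha>\<^sub>3 / \<delta>\<^sub>3) (\<Phi> p))"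
proof -
  define u where "u p = sol_potential ((\<delta>\<^sub>3 / \<alpha>\<^sub>2)\<^sup>2) (\<alpha>\<^sub>3 / \<delta>\<^sub>3) (\<Phi> p)" for p
  have "continuous_on UNIV (sol_potential ((\<delta>\<^sub>3 / \<alpha>\<^sub>2)\<^sup>2) (\<alpha>\<^sub>3 / \<delta>\<^sub>3))"
    by (intro differentiable_imp_continuous_on differentiable_at_imp_differentiable_on
        sol_potential_differentiable zero_le_power2)
  then have u: "continuous_map T euclideanreal u"
    unfolding u_def[abs_def] using continuous_map_compose[OF continuous_\<Phi>, of euclideanreal] by (simp add: o_def)
  have lsc: "openin T {p \<in> topspace T. t < u p}" for t
    using openin_continuous_map_preimage[OF u, of "{t<..}"] by simp
  have "h p0 \<le> u p0"
    if \<Omega>: "openin T \<Omega>" "compactin T (T closure_of \<Omega>)"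
      and h: "continuous_map (subtopology T (T closure_of \<Omega>)) euclideanreal h"
      and harm: "harmonic_on A g \<Omega> h" and bd: "\<forall>p\<in>T frontier_of \<Omega>. h p \<le> u p" and p0: "p0 \<in> \<Omega>"
    for \<Omega> h p0
  proof (rule ccontr)
    assume neg: "\<not> h p0 \<le> u p0"
    let ?K = "T closure_of \<Omega>"
    have \<Omega>_K: "\<Omega> \<subseteq> ?K" using \<Omega>(1) by (simp add: closure_of_subset openin_subset)
    have "continuous_map (subtopology T ?K) euclideanreal (\<lambda>p. h p - u p)"
      by (rule continuous_map_diff[OF h continuous_map_from_subtopology[OF u]])
    moreover have "compactin (subtopology T ?K) ?K" using \<Omega>(2) by (simp add: compactin_subtopology)
    ultimately have "compactin euclideanreal ((\<lambda>p. h p - u p) ` ?K)" by (rule image_compactin[rotated])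
    moreover have "(\<lambda>p. h p - u p) ` ?K \<noteq> {}" using p0 \<Omega>_K by auto
    ultimately obtain p1 where p1: "p1 \<in> ?K" "\<And>p. p \<in> ?K \<Longrightarrow> h p - u p \<le> h p1 - u p1"
      using compact_attains_sup[of "(\<lambda>p. h p - u p) ` ?K"] by auto
    \<comment> \<open>The maximum is at least the positive value at \<open>p0\<close>, whereas
      \<open>h - u\<close> is at most 0 on the frontier.\<close>
    have "h p1 > u p1" using p1(2)[of p0] p0 \<Omega>_K neg by auto
    then have "p1 \<notin> T frontier_of \<Omega>" using bd by auto
    then have p1\<Omega>: "p1 \<in> \<Omega>" using p1(1) \<Omega>(1) by (simp add: frontier_of_def interior_of_openin)
    then obtain c where c: "c \<in> A" "p1 \<in> fst c"
      using chart_at openin_subset[OF \<Omega>(1)] by blast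
    interpret sol_chart m \<alpha>\<^sub>2 \<alpha>\<^sub>3 \<beta>\<^sub>1 \<beta>\<^sub>2 \<beta>\<^sub>3 \<delta>\<^sub>3 e1 e2 e3 "U c" "V c" "\<phi> c" "\<psi> c" "g c"
      by (rule chart_locale[OF basis c(1)])
    have inv: "chart_inv c (snd c p) = p" if "p \<in> fst c" for p by (rule chart_inv(1)[OF c(1) that])
    show False
    proof (rule no_interior_maximum)
      have "openin (subtopology T (fst c)) (fst c \<inter> \<Omega>)"
        using \<Omega>(1) by (auto simp: openin_subtopology)
      then have "openin (top_of_set (U c)) (snd c ` (fst c \<inter> \<Omega>))"
        using homeomorphic_imp_open_map[OF chart(3)[OF c(1)]] by (simp add: open_map_def)
      then show "open (snd c ` (fst c \<inter> \<Omega>))"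
        using chart(2)[OF c(1)] openin_open_trans by blast
      show "snd c ` (fst c \<inter> \<Omega>) \<subseteq> U c" by auto
      show "snd c p1 \<in> snd c ` (fst c \<inter> \<Omega>)" using c p1\<Omega> by auto
      show "C_k_on 2 (snd c ` (fst c \<inter> \<Omega>)) (\<lambda>x. h (chart_inv c x))"
        using harm c(1) by (simp add: harmonic_on_def)
      show "laplacian (g c) (\<lambda>x. h (chart_inv c x)) (snd c p1) = 0"
        using harm c p1\<Omega> by (simp add: harmonic_on_def laplace_beltrami_def)
      fix y assume "y \<in> snd c ` (fst c \<inter> \<Omega>)"
      then obtain p where p: "p \<in> fst c" "p \<in> \<Omega>" "y = snd c p" by auto
      then show "h (chart_inv c y) - potential (\<phi> c y)
          \<le> h (chart_inv c (snd c p1)) - potential (\<phi> c (snd c p1))"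
        using p1(2)[of p] \<Omega>_K c by (auto simp: inv \<phi>_def u_def)
    qed
  qed
  then have "superharmonic T A g u"
    unfolding superharmonic_def using lsc by blast
  then show ?thesis by (simp add: u_def[abs_def])
qed

lemma not_parabolic: "\<not> parabolic T A g"
proof -
  obtain \<alpha>\<^sub>2 \<alpha>\<^sub>3 \<beta>\<^sub>1 \<beta>\<^sub>2 \<beta>\<^sub>3 \<delta>\<^sub>3 e1 e2 e3 where
    basis: "sol_basis m \<alpha>\<^sub>2 \<alpha>\<^sub>3 \<beta>\<^sub>1 \<beta>\<^sub>2 \<beta>\<^sub>3 \<delta>\<^sub>3 e1 e2 e3"
    using sol_basis_exists[OF m_inner] by blast
  define b where "b = \<alpha>\<^sub>3 / \<delta>\<^sub>3"
  let ?u = "sol_potential ((\<delta>\<^sub>3 / \<alpha>\<^sub>2)\<^sup>2) b"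
  \<comment> \<open>Both points satisfy \<open>x = b * exp z\<close>, so the quadratic takes the
    values 2 and \<open>1 + (exp 1) ^ 2\<close> there.\<close>
  have "?u (b, 0, 0) \<noteq> ?u (b * exp 1, 0, 1)"
  proof -
    have "1 < (exp 1 :: real)\<^sup>2" by (rule one_less_power) simp_all
    then have "(exp 1 :: real)\<^sup>2 \<noteq> 1" by (rule less_imp_neq[THEN not_sym])
    then show ?thesis by (simp add: sol_potential_def sol_quadratic_def)
  qed
  \<comment> \<open>Both points are values of \<open>\<Phi>\<close>, so a constant function on the
    group would agree at them.\<close>
  moreover have "?u (b, 0, 0) = k \<and> ?u (b * exp 1, 0, 1) = k" if "\<forall>p\<in>topspace T. ?u (\<Phi> p) = k" for k
    using that \<Psi>_in \<Phi>_\<Psi> by metis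
  ultimately have "\<not> (\<exists>k. \<forall>p\<in>topspace T. ?u (\<Phi> p) = k)"
    by metis
  then show ?thesis
    using superharmonic_potential[OF basis] sol_potential_pos[OF zero_le_power2]
    unfolding parabolic_def b_def by blast
qed

end

theorem theorem1:
  fixes G :: "'a monoid" and T :: "'a topology"
    and A :: "('a, 'e::euclidean_space) chart set" and g :: "('a, 'e) metric"
  assumes "metric_lie_group G T A g"
    and "lie_group_isomorphic G T A Sol3 euclidean euclidean_atlas"
  shows "\<not> parabolic T A g"
proof -
  obtain \<Phi> where "metric_sol_group G T A g \<Phi>"
    using assms by (auto simp: lie_group_isomorphic_def metric_sol_group_def)
  then show ?thesis by (rule metric_sol_group.not_parabolic)
qed

end
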